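(* Let $\Omega=[x^1_{\min},x^1_{\max}]\times[x^2_{\min},x^2_{\max}]\times[x^3_{\min},x^3_{\max}]\subset\mathbb{R}^3$ and $0<\alpha<1$. For sufficiently smooth scalar and vector fields on $\Omega$, the Tarasov fractional vector calculus operators satisfy $$\operatorname{grad}_T^{\alpha}=\mathcal{I}^{1-\alpha}_{1}\operatorname{grad},\qquad \operatorname{curl}_T^{\alpha}=\mathcal{I}^{1-\alpha}_{2}\operatorname{curl}\,{}^{RL}\mathcal{D}^{1-\alpha}_{1},\qquad \operatorname{div}_T^{\alpha}=\mathcal{I}^{1-\alpha}_{3}\operatorname{div}\,{}^{RL}\mathcal{D}^{1-\alpha}_{2},$$ where scalar and vector fields are identified with differential forms in the usual way.
   Context: For a function $f$ on $\Omega$, a coordinate index $j$ and $\beta>0$, the left-sided Riemann-Liouville partial fractional integral is $$I^{\beta}_{x^j}f=\frac{1}{\Gamma(\beta)}\int_{x^j_{\min}}^{x^j}\frac{f(\dots,x^{j-1},x',x^{j+1},\dots)}{(x^j-x')^{1-\beta}}\,dx'.$$ Let $D^n_{x^j}$ be the $n$-th partial derivative in $x^j$. With $n=\lfloor\beta\rfloor+1$, ${}^{RL}D^{\beta}_{x^j}f=D^n_{x^j}I^{n-\beta}_{x^j}f$ (Riemann-Liouville), and for non-integer $\beta$, ${}^{C}D^{\beta}_{x^j}f=I^{n-\beta}_{x^j}D^n_{x^j}f$ (Caputo). Tarasov's operators: with $\nabla^\alpha_C=\mathbf{e}_1{}^{C}D^{\alpha}_{x^1}+\mathbf{e}_2{}^{C}D^{\alpha}_{x^2}+\mathbf{e}_3{}^{C}D^{\alpha}_{x^3}$,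 set $\operatorname{grad}_T^\alpha f=\nabla^\alpha_C f$, $\operatorname{curl}_T^\alpha \bm{F}=\nabla^\alpha_C\times\bm{F}$, $\operatorname{div}_T^\alpha\bm{F}=\nabla^\alpha_C\cdot\bm{F}$. Identifications in 3D: a vector field $(F_1,F_2,F_3)$ corresponds to the 1-form $F_1dx^1+F_2dx^2+F_3dx^3$ and to the 2-form $F_1dx^2\wedge dx^3+F_2dx^3\wedge dx^1+F_3dx^1\wedge dx^2$; a scalar $g$ corresponds to the 3-form $g\,dx^1\wedge dx^2\wedge dx^3$. On a $p$-form ($p\ge1$) written as $\sum_J a_J dx^J$ over $J=(i_1<\cdots<i_p)$, with $dx^J=dx^{i_1}\wedge\cdots\wedge dx^{i_p}$, define $$\mathcal{I}^{\beta}_{p}\Big(\sum_J a_Jdx^J\Big)=\sum_J\big(I^{\beta}_{x^{i_1}}\cdots I^{\beta}_{x^{i_p}}a_J\big)dx^J,\qquad {}^{RL}\mathcal{D}^{\beta}_{p}\Big(\sum_J a_Jdx^J\Big)=\sum_J\big({}^{RL}D^{\beta}_{x^{i_1}}\cdots{}^{RL}D^{\beta}_{x^{i_p}}a_J\big)dx^J.$$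
   Formalization: The curl and div identities are proved at all points of Ω off the lower faces x^j = x^j_min, where the right-hand sides are singular or vanish and the pointwise identity fails (e.g. F=(0,0,x^2)); "sufficiently smooth" is taken as C^1, C^2, C^3 for grad, curl, div. *)

theory Defs
  imports "HOL-Analysis.Analysis"
begin

text \<open>
  The domain is the box \<^term>\<open>cbox a b\<close> in real three-space. Fields are total functions, but at a
  point of the box every operator below uses only their values on the box. In the index type
  \<^typ>\<open>3\<close> the numeral \<open>3\<close> equals \<open>0\<close>, so its order is not that of the coordinates 1, 2, 3.
\<close>

type_synonym scalar_field = "real^3 \<Rightarrow> real"
type_synonym vector_field = "real^3 \<Rightarrow> real^3"

definition upd_coord :: "real^3 \<Rightarrow> 3 \<Rightarrow> real \<Rightarrow> real^3" where
  "upd_coord x j t = (\<chi> i. if i = j then t else x $ i)"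

text \<open>Partial derivatives are one-sided on the faces of the box.\<close>

definition partial_deriv :: "real^3 \<Rightarrow> real^3 \<Rightarrow> 3 \<Rightarrow> scalar_field \<Rightarrow> scalar_field" where
  "partial_deriv a b j f =
     (\<lambda>x. vector_derivative (\<lambda>t. f (upd_coord x j t)) (at (x $ j) within {a $ j..b $ j}))"

primrec Ck_on_box :: "nat \<Rightarrow> real^3 \<Rightarrow> real^3 \<Rightarrow> scalar_field \<Rightarrow> bool" where
  "Ck_on_box 0 a b f \<longleftrightarrow> continuous_on (cbox a b) f"
| "Ck_on_box (Suc k) a b f \<longleftrightarrow> continuous_on (cbox a b) f \<and>
     (\<forall>j. (\<forall>x\<in>cbox a b.
             (\<lambda>t. f (upd_coord x j t)) differentiable (at (x $ j) within {a $ j..b $ j})) \<and>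
          Ck_on_box k a b (partial_deriv a b j f))"

definition Ck_vector_on_box :: "nat \<Rightarrow> real^3 \<Rightarrow> real^3 \<Rightarrow> vector_field \<Rightarrow> bool" where
  "Ck_vector_on_box k a b F \<longleftrightarrow> (\<forall>i. Ck_on_box k a b (\<lambda>x. F x $ i))"

text \<open>
  The kernel may be singular at the upper limit; the gauge integral covers both the Lebesgue and
  the improper Riemann reading, and the value of the integrand at a single point is irrelevant.
\<close>

definition rl_integral :: "real^3 \<Rightarrow> real \<Rightarrow> 3 \<Rightarrow> scalar_field \<Rightarrow> scalar_field" where
  "rl_integral a \<beta> j f =
     (\<lambda>x. 1 / Gamma \<beta> *
        integral {a $ j..x $ j} (\<lambda>t. f (upd_coord x j t) / (x $ j - t) powr (1 - \<beta>)))"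

definition frac_order :: "real \<Rightarrow> nat" where
  "frac_order \<beta> = nat \<lfloor>\<beta>\<rfloor> + 1"

definition rl_deriv :: "real^3 \<Rightarrow> real^3 \<Rightarrow> real \<Rightarrow> 3 \<Rightarrow> scalar_field \<Rightarrow> scalar_field" where
  "rl_deriv a b \<beta> j f =
     (partial_deriv a b j ^^ frac_order \<beta>) (rl_integral a (real (frac_order \<beta>) - \<beta>) j f)"

text \<open>Meant for non-integer \<open>\<beta>\<close> only.\<close>

definition caputo_deriv :: "real^3 \<Rightarrow> real^3 \<Rightarrow> real \<Rightarrow> 3 \<Rightarrow> scalar_field \<Rightarrow> scalar_field" where
  "caputo_deriv a b \<beta> j f =
     rl_integral a (real (frac_order \<beta>) - \<beta>) j ((partial_deriv a b j ^^ frac_order \<beta>) f)"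

text \<open>
  Formal products of a vector of scalar operators
  \<open>\<nabla> = e\<^sub>1 (op 1) + e\<^sub>2 (op 2) + e\<^sub>3 (op 3)\<close> with a field.
\<close>

definition nabla_grad :: "(3 \<Rightarrow> scalar_field \<Rightarrow> scalar_field) \<Rightarrow> scalar_field \<Rightarrow> vector_field" where
  "nabla_grad op f = (\<lambda>x. vector [op 1 f x, op 2 f x, op 3 f x])"

definition nabla_curl :: "(3 \<Rightarrow> scalar_field \<Rightarrow> scalar_field) \<Rightarrow> vector_field \<Rightarrow> vector_field" where
  "nabla_curl op F = (\<lambda>x. vector
     [op 2 (\<lambda>y. F y $ 3) x - op 3 (\<lambda>y. F y $ 2) x,
      op 3 (\<lambda>y. F y $ 1) x - op 1 (\<lambda>y. F y $ 3) x,
      op 1 (\<lambda>y. F y $ 2) x - op 2 (\<lambda>y. F y $ 1) x])"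

definition nabla_div :: "(3 \<Rightarrow> scalar_field \<Rightarrow> scalar_field) \<Rightarrow> vector_field \<Rightarrow> scalar_field" where
  "nabla_div op F =
     (\<lambda>x. op 1 (\<lambda>y. F y $ 1) x + op 2 (\<lambda>y. F y $ 2) x + op 3 (\<lambda>y. F y $ 3) x)"

definition grad_field :: "real^3 \<Rightarrow> real^3 \<Rightarrow> scalar_field \<Rightarrow> vector_field" where
  "grad_field a b = nabla_grad (partial_deriv a b)"

definition curl_field :: "real^3 \<Rightarrow> real^3 \<Rightarrow> vector_field \<Rightarrow> vector_field" where
  "curl_field a b = nabla_curl (partial_deriv a b)"

definition div_field :: "real^3 \<Rightarrow> real^3 \<Rightarrow> vector_field \<Rightarrow> scalar_field" where
  "div_field a b = nabla_div (partial_deriv a b)"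

definition grad_T :: "real^3 \<Rightarrow> real^3 \<Rightarrow> real \<Rightarrow> scalar_field \<Rightarrow> vector_field" where
  "grad_T a b \<alpha> = nabla_grad (caputo_deriv a b \<alpha>)"

definition curl_T :: "real^3 \<Rightarrow> real^3 \<Rightarrow> real \<Rightarrow> vector_field \<Rightarrow> vector_field" where
  "curl_T a b \<alpha> = nabla_curl (caputo_deriv a b \<alpha>)"

definition div_T :: "real^3 \<Rightarrow> real^3 \<Rightarrow> real \<Rightarrow> vector_field \<Rightarrow> scalar_field" where
  "div_T a b \<alpha> = nabla_div (caputo_deriv a b \<alpha>)"

text \<open>
  A \<open>p\<close>-form is given by its coefficients: \<open>\<omega> J\<close> is the coefficient of
  \<open>dx\<^sup>J = dx\<^sup>i \<and> \<dots>\<close>, the indices \<open>i\<close> in \<open>J\<close> taken in increasing order, for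
  \<open>J \<subseteq> {1,2,3}\<close> of cardinality \<open>p\<close>; all other coefficients are zero.
\<close>

type_synonym diff_form = "nat set \<Rightarrow> scalar_field"

text \<open>
  \<open>map_form op p\<close> replaces each coefficient \<open>\<omega> J\<close>, with \<open>i\<^sub>1 < \<dots> < i\<^sub>p\<close> the elements of \<open>J\<close>,
  by \<open>op i\<^sub>1 (\<dots> (op i\<^sub>p (\<omega> J)))\<close>.
\<close>

definition map_form ::
    "(3 \<Rightarrow> scalar_field \<Rightarrow> scalar_field) \<Rightarrow> nat \<Rightarrow> diff_form \<Rightarrow> diff_form" where
  "map_form op p \<omega> =
     (\<lambda>J. if J \<subseteq> {1..3} \<and> card J = p
          then foldr (\<lambda>i. op (of_nat i)) (sorted_list_of_set J) (\<omega> J)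
          else (\<lambda>x. 0))"

definition frac_integral_form :: "real^3 \<Rightarrow> nat \<Rightarrow> real \<Rightarrow> diff_form \<Rightarrow> diff_form" where
  "frac_integral_form a p \<beta> = map_form (rl_integral a \<beta>) p"

definition rl_deriv_form :: "real^3 \<Rightarrow> real^3 \<Rightarrow> nat \<Rightarrow> real \<Rightarrow> diff_form \<Rightarrow> diff_form" where
  "rl_deriv_form a b p \<beta> = map_form (rl_deriv a b \<beta>) p"

definition one_form :: "vector_field \<Rightarrow> diff_form" where
  "one_form F =
     (\<lambda>J x. if J = {1} then F x $ 1
            else if J = {2} then F x $ 2
            else if J = {3} then F x $ 3 else 0)"

text \<open>The sign below is that of \<open>dx\<^sup>3 \<and> dx\<^sup>1 = - dx\<^sup>1 \<and> dx\<^sup>3\<close>.\<close>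

definition two_form :: "vector_field \<Rightarrow> diff_form" where
  "two_form F =
     (\<lambda>J x. if J = {2,3} then F x $ 1
            else if J = {1,3} then - (F x $ 2)
            else if J = {1,2} then F x $ 3 else 0)"

definition three_form :: "scalar_field \<Rightarrow> diff_form" where
  "three_form g = (\<lambda>J x. if J = {1,2,3} then g x else 0)"

text \<open>The inverse identifications.\<close>

definition field_of_one_form :: "diff_form \<Rightarrow> vector_field" where
  "field_of_one_form \<omega> = (\<lambda>x. vector [\<omega> {1} x, \<omega> {2} x, \<omega> {3} x])"

definition field_of_two_form :: "diff_form \<Rightarrow> vector_field" where
  "field_of_two_form \<omega> = (\<lambda>x. vector [\<omega> {2,3} x, - \<omega> {1,3} x, \<omega> {1,2} x])"

definition field_of_three_form :: "diff_form \<Rightarrow> scalar_field" where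
  "field_of_three_form \<omega> = \<omega> {1,2,3}"

end

theory Submission
  imports Defs
begin

text \<open>
  For a single coordinate, $D^{1-\alpha} = \partial I^{\alpha}$ is inverted from the left by
  $I^{1-\alpha}$ on functions of class $C^1$ (\<open>rl_integral_rl_deriv\<close>; Abel's equation). The Caputo
  derivative being $I^{1-\alpha}\partial$, the identity for the gradient is its definition; in the
  curl the term $I_i I_j\, \partial_i D_j f$ becomes $I_i\, \partial_i f$ once $\partial_i$ is moved past
  $D_j$ and then $D_j$ is cancelled by $I_j$, and in the divergence the same happens twice. What has
  to be justified is that $\partial_i$ commutes with $D_j$ (\<open>partial_deriv_rl_deriv\<close>), that $I_i$
  commutes with $I_j$ (\<open>rl_integral_commute\<close>), and that all integrals converge.

  The difficulty is that $D_j f$ is singular on the face $x_j = a_j$, where it behaves like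
  $(x_j - a_j)^{\alpha-1}$. All functions that occur are of the form $\prod_j (x_j - a_j)^{p_j-1}\, h(x)$ with
  $p_j > 0$ and \<open>h\<close> of class $C^k$ up to the boundary (\<open>weighted\<close>). The substitution
  $t = a_j + s\,(x_j - a_j)$ turns the integral $I_j^{\beta}$ of such a function into a power of
  $x_j - a_j$ times a mean of \<open>h\<close> over \<open>s\<close> in $[0,1]$ against the finite measure with density
  $s^{p_j-1}(1-s)^{\beta-1}$. These means preserve $C^k$, may be differentiated under the integral sign,
  and commute by Fubini's theorem for finite measures and bounded functions. In the same way
  $D_j h = (x_j - a_j)^{\alpha-1} N_j h$, where $N_j h$ (\<open>deriv_mean\<close>) is regular on the closed box.
  Abel's inversion becomes a statement on $[0,1]$: the product of two independent
  Beta variables is again a Beta variable (\<open>beta_measure_mult\<close>).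
\<close>

section \<open>Coordinates and fields of class $C^k$ on a box\<close>

lemma upd_coord_nth [simp]: "upd_coord x j t $ i = (if i = j then t else x $ i)"
  by (simp add: upd_coord_def)

lemma upd_coord_same [simp]: "upd_coord x j (x $ j) = x"
  by (simp add: vec_eq_iff)

lemma upd_coord_upd [simp]: "upd_coord (upd_coord x j s) j t = upd_coord x j t"
  by (simp add: vec_eq_iff)

lemma upd_coord_commute:
  "i \<noteq> j \<Longrightarrow> upd_coord (upd_coord x i s) j t = upd_coord (upd_coord x j t) i s"
  by (simp add: vec_eq_iff)

lemma continuous_on_upd_coord [continuous_intros]:
  assumes "continuous_on A f" "continuous_on A g"
  shows "continuous_on A (\<lambda>z. upd_coord (f z) j (g z))"
proof -
  have "continuous_on A (\<lambda>z. if i = j then g z else f z $ i)" for i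
    using assms by (cases "i = j") (auto intro!: continuous_intros)
  then show ?thesis
    unfolding upd_coord_def by (intro continuous_on_vec_lambda)
qed

lemma upd_coord_in_box:
  assumes "x \<in> cbox a b" "t \<in> {a $ j..b $ j}"
  shows "upd_coord x j t \<in> cbox a b"
  using assms by (auto simp: mem_box_cart)

text \<open>
  \<open>has_partial a b j f g\<close> says that \<open>g\<close> is, on the whole closed box, the partial derivative of
  \<open>f\<close> in the coordinate \<open>j\<close>, one-sided on the two faces orthogonal to that coordinate.
\<close>

definition has_partial :: "real^3 \<Rightarrow> real^3 \<Rightarrow> 3 \<Rightarrow> scalar_field \<Rightarrow> scalar_field \<Rightarrow> bool" where
  "has_partial a b j f g \<longleftrightarrow> (\<forall>x\<in>cbox a b.
     ((\<lambda>t. f (upd_coord x j t)) has_real_derivative g x) (at (x $ j) within {a $ j..b $ j}))"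

lemma has_partialD:
  assumes "has_partial a b j f g" "x \<in> cbox a b" "t \<in> {a $ j..b $ j}"
  shows "((\<lambda>t. f (upd_coord x j t)) has_real_derivative g (upd_coord x j t))
           (at t within {a $ j..b $ j})"
  using assms(1)[unfolded has_partial_def, rule_format, OF upd_coord_in_box[OF assms(2,3)]] by simp

lemma has_partial_cong:
  assumes "has_partial a b j f g" "\<And>x. x \<in> cbox a b \<Longrightarrow> f x = f' x" "\<And>x. x \<in> cbox a b \<Longrightarrow> g x = g' x"
  shows "has_partial a b j f' g'"
  unfolding has_partial_def
proof
  fix x assume x: "x \<in> cbox a b"
  have "((\<lambda>t. f (upd_coord x j t)) has_real_derivative g' x) (at (x $ j) within {a $ j..b $ j})"
    using assms(1,3) x unfolding has_partial_def by auto
  then show "((\<lambda>t. f' (upd_coord x j t)) has_real_derivative g' x) (at (x $ j) within {a $ j..b $ j})"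
    by (rule has_field_derivative_transform_within[OF _ zero_less_one])
       (use x assms(2) upd_coord_in_box[OF x] in \<open>auto simp: mem_box_cart\<close>)
qed

lemma partial_deriv_eqI:
  assumes "((\<lambda>t. f (upd_coord x j t)) has_real_derivative D) (at (x $ j) within {a $ j..b $ j})"
    and "x \<in> cbox a b" "a $ j < b $ j"
  shows "partial_deriv a b j f x = D"
  unfolding partial_deriv_def
  by (rule vector_derivative_within_cbox[of "a $ j" "b $ j", unfolded cbox_interval])
     (use assms in \<open>auto simp: has_real_derivative_iff_has_vector_derivative mem_box_cart\<close>)

lemma partial_deriv_eq:
  assumes "has_partial a b j f g" "x \<in> cbox a b" "a $ j < b $ j"
  shows "partial_deriv a b j f x = g x"
  using assms by (intro partial_deriv_eqI) (auto simp: has_partial_def)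

lemma Ck_on_box_imp_continuous: "Ck_on_box k a b f \<Longrightarrow> continuous_on (cbox a b) f"
  by (cases k) auto

context
  fixes a b :: "real^3"
  assumes box: "\<And>j. a $ j < b $ j"
begin

lemma Ck_on_box_SucD:
  assumes "Ck_on_box (Suc k) a b f"
  shows "has_partial a b j f (partial_deriv a b j f)" "Ck_on_box k a b (partial_deriv a b j f)"
proof -
  show "has_partial a b j f (partial_deriv a b j f)"
    unfolding has_partial_def
  proof
    fix x assume x: "x \<in> cbox a b"
    then have "(\<lambda>t. f (upd_coord x j t)) differentiable (at (x $ j) within {a $ j..b $ j})"
      using assms by auto
    then obtain D where D: "((\<lambda>t. f (upd_coord x j t)) has_real_derivative D) (at (x $ j) within {a $ j..b $ j})"
      by (auto simp: real_differentiable_def)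
    with partial_deriv_eqI[OF D x box] show "((\<lambda>t. f (upd_coord x j t)) has_real_derivative partial_deriv a b j f x)
      (at (x $ j) within {a $ j..b $ j})" by simp
  qed
qed (use assms in auto)

lemma Ck_on_box_cong:
  "Ck_on_box k a b f \<Longrightarrow> (\<And>x. x \<in> cbox a b \<Longrightarrow> f x = g x) \<Longrightarrow> Ck_on_box k a b g"
proof (induction k arbitrary: f g)
  case 0
  then show ?case by (auto simp: continuous_on_eq)
next
  case (Suc k)
  have hp: "has_partial a b j g (partial_deriv a b j f)" for j
    by (rule has_partial_cong[OF Ck_on_box_SucD(1)[OF Suc.prems(1)]]) (use Suc.prems in auto)
  have "Ck_on_box k a b (partial_deriv a b j g)" for j
    by (rule Suc.IH[OF Ck_on_box_SucD(2)[OF Suc.prems(1)]]) (simp add: partial_deriv_eq[OF hp] box)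
  moreover have "continuous_on (cbox a b) g"
    using Suc.prems by (auto simp: continuous_on_eq)
  ultimately show ?case
    using hp by (auto simp: has_partial_def real_differentiable_def)
qed

lemma Ck_on_box_SucI:
  assumes "continuous_on (cbox a b) f"
    and "\<And>j. has_partial a b j f (f' j)" "\<And>j. Ck_on_box k a b (f' j)"
  shows "Ck_on_box (Suc k) a b f"
proof -
  have "Ck_on_box k a b (partial_deriv a b j f)" for j
    by (rule Ck_on_box_cong[OF assms(3)[of j]]) (simp add: partial_deriv_eq[OF assms(2)] box)
  then show ?thesis
    using assms by (auto simp: has_partial_def real_differentiable_def)
qed

lemma Ck_on_box_Suc_imp: "Ck_on_box (Suc k) a b f \<Longrightarrow> Ck_on_box k a b f"
proof (induction k arbitrary: f)
  case (Suc k)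
  show ?case
    by (rule Ck_on_box_SucI[of _ "\<lambda>j. partial_deriv a b j f"])
       (use Ck_on_box_SucD[OF Suc.prems] Suc.IH Ck_on_box_imp_continuous[OF Suc.prems] in auto)
qed simp

lemma has_partial_add:
  "has_partial a b j f f' \<Longrightarrow> has_partial a b j g g' \<Longrightarrow>
     has_partial a b j (\<lambda>x. f x + g x) (\<lambda>x. f' x + g' x)"
  unfolding has_partial_def by (auto intro!: DERIV_add)

lemma has_partial_cmult:
  "has_partial a b j f f' \<Longrightarrow> has_partial a b j (\<lambda>x. c * f x) (\<lambda>x. c * f' x)"
  unfolding has_partial_def by (auto intro!: DERIV_cmult)

lemma has_partial_coord_mult:
  assumes "has_partial a b i f f'"
  shows "has_partial a b i (\<lambda>x. (x $ j - a $ j) * f x)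
           (\<lambda>x. (x $ j - a $ j) * f' x + (if i = j then 1 else 0) * f x)"
  using assms unfolding has_partial_def
  by (cases "i = j") (auto intro!: derivative_eq_intros simp: fun_eq_iff)

lemma Ck_on_box_add:
  "Ck_on_box k a b f \<Longrightarrow> Ck_on_box k a b g \<Longrightarrow> Ck_on_box k a b (\<lambda>x. f x + g x)"
proof (induction k arbitrary: f g)
  case (Suc k)
  note f = Ck_on_box_SucD[OF Suc.prems(1)] and g = Ck_on_box_SucD[OF Suc.prems(2)]
  show ?case
    by (rule Ck_on_box_SucI[OF _ has_partial_add[OF f(1) g(1)] Suc.IH[OF f(2) g(2)]])
       (use Suc.prems Ck_on_box_imp_continuous in \<open>auto intro!: continuous_intros\<close>)
qed (auto intro!: continuous_intros)

lemma Ck_on_box_cmult: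
  "Ck_on_box k a b f \<Longrightarrow> Ck_on_box k a b (\<lambda>x. c * f x)"
proof (induction k arbitrary: f)
  case (Suc k)
  note f = Ck_on_box_SucD[OF Suc.prems(1)]
  show ?case
    by (rule Ck_on_box_SucI[OF _ has_partial_cmult[OF f(1)] Suc.IH[OF f(2)]])
       (use Suc.prems Ck_on_box_imp_continuous in \<open>auto intro!: continuous_intros\<close>)
qed (auto intro!: continuous_intros)

lemma Ck_on_box_coord_mult:
  "Ck_on_box k a b f \<Longrightarrow> Ck_on_box k a b (\<lambda>x. (x $ j - a $ j) * f x)"
proof (induction k arbitrary: f)
  case (Suc k)
  note f = Ck_on_box_SucD[OF Suc.prems(1)]
  show ?case
    by (rule Ck_on_box_SucI[OF _ has_partial_coord_mult[OF f(1)]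
          Ck_on_box_add[OF Suc.IH[OF f(2)] Ck_on_box_cmult[OF Ck_on_box_Suc_imp[OF Suc.prems]]]])
       (use Suc.prems Ck_on_box_imp_continuous in \<open>auto intro!: continuous_intros\<close>)
qed (auto intro!: continuous_intros)

text \<open>
  Symmetry of the second derivatives up to the boundary: by the fundamental theorem in the
  coordinate \<open>j\<close>, $\partial_i f$ is its value on the lower face plus the integral of
  $\partial_i\partial_j f$.
\<close>

lemma partial_deriv_commute:
  assumes f: "Ck_on_box (Suc (Suc 0)) a b f" and ij: "i \<noteq> j" and x: "x \<in> cbox a b"
  shows "partial_deriv a b i (partial_deriv a b j f) x
           = partial_deriv a b j (partial_deriv a b i f) x"
proof -
  define fi where "fi = partial_deriv a b i f"
  define fj where "fj = partial_deriv a b j f"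
  define fij where "fij = partial_deriv a b i fj"
  have fi: "has_partial a b i f fi" and fj: "has_partial a b j f fj" "continuous_on (cbox a b) fj"
    and fij: "has_partial a b i fj fij" "continuous_on (cbox a b) fij"
    using Ck_on_box_SucD[OF f] Ck_on_box_SucD[OF Ck_on_box_SucD(2)[OF f]]
    by (auto simp: fi_def fj_def fij_def)
  have cont: "continuous_on {a $ j..b $ j} (\<lambda>s. g (upd_coord y j s))"
    if "continuous_on (cbox a b) g" "y \<in> cbox a b" for g :: scalar_field and y
    by (rule continuous_on_compose2[OF that(1)])
       (use that upd_coord_in_box in \<open>auto intro!: continuous_intros\<close>)
  have ftc: "f y = f (upd_coord y j (a $ j)) + integral {a $ j..y $ j} (\<lambda>s. fj (upd_coord y j s))"
    if y: "y \<in> cbox a b" for y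
  proof -
    have "((\<lambda>s. fj (upd_coord y j s)) has_integral
            f (upd_coord y j (y $ j)) - f (upd_coord y j (a $ j))) {a $ j..y $ j}"
    proof (rule fundamental_theorem_of_calculus)
      fix s assume "s \<in> {a $ j..y $ j}"
      with y have "s \<in> {a $ j..b $ j}" by (auto simp: mem_box_cart intro: order_trans)
      from has_partialD[OF fj(1) y this]
      have "((\<lambda>s. f (upd_coord y j s)) has_real_derivative fj (upd_coord y j s))
              (at s within {a $ j..y $ j})"
        by (rule DERIV_subset) (use y in \<open>auto simp: mem_box_cart intro: order_trans\<close>)
      then show "((\<lambda>s. f (upd_coord y j s)) has_vector_derivative fj (upd_coord y j s))
              (at s within {a $ j..y $ j})"
        by (simp add: has_real_derivative_iff_has_vector_derivative)
    qed (use y in \<open>auto simp: mem_box_cart\<close>)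
    then show ?thesis by (simp add: integral_unique)
  qed
  have deriv: "fi y = fi (upd_coord y j (a $ j)) + integral {a $ j..y $ j} (\<lambda>s. fij (upd_coord y j s))"
    if y: "y \<in> cbox a b" for y
  proof -
    have sub: "s \<in> {a $ j..b $ j}" if "s \<in> {a $ j..y $ j}" for s
      using that y by (auto simp: mem_box_cart intro: order_trans)
    have aj: "upd_coord y j (a $ j) \<in> cbox a b"
      by (rule upd_coord_in_box[OF y]) (use box in \<open>auto intro: less_imp_le\<close>)
    have "((\<lambda>t. integral (cbox (a $ j) (y $ j)) (\<lambda>s. fj (upd_coord (upd_coord y i t) j s)))
       has_real_derivative integral (cbox (a $ j) (y $ j)) (\<lambda>s. fij (upd_coord (upd_coord y i (y $ i)) j s)))
       (at (y $ i) within {a $ i..b $ i})"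
    proof (rule leibniz_rule_field_derivative)
      fix t s assume t: "t \<in> {a $ i..b $ i}" and s: "s \<in> cbox (a $ j) (y $ j)"
      have "upd_coord y j s \<in> cbox a b" using upd_coord_in_box[OF y sub] s by auto
      from has_partialD[OF fij(1) this t]
      show "((\<lambda>t. fj (upd_coord (upd_coord y i t) j s)) has_real_derivative
             fij (upd_coord (upd_coord y i t) j s)) (at t within {a $ i..b $ i})"
        by (simp add: upd_coord_commute[OF ij])
    next
      fix t assume t: "t \<in> {a $ i..b $ i}"
      have "continuous_on {a $ j..y $ j} (\<lambda>s. fj (upd_coord (upd_coord y i t) j s))"
        by (rule continuous_on_subset[OF cont[OF fj(2) upd_coord_in_box[OF y t]]]) (use sub in auto)
      then show "(\<lambda>s. fj (upd_coord (upd_coord y i t) j s)) integrable_on cbox (a $ j) (y $ j)"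
        by (intro integrable_continuous) simp
    next
      show "continuous_on ({a $ i..b $ i} \<times> cbox (a $ j) (y $ j))
              (\<lambda>(t, s). fij (upd_coord (upd_coord y i t) j s))"
        unfolding split_beta
        by (rule continuous_on_compose2[OF fij(2)])
           (use sub in \<open>auto intro!: continuous_intros upd_coord_in_box y\<close>)
    qed (use y in \<open>auto simp: mem_box_cart\<close>)
    then have 1: "((\<lambda>t. integral {a $ j..y $ j} (\<lambda>s. fj (upd_coord (upd_coord y i t) j s)))
       has_real_derivative integral {a $ j..y $ j} (\<lambda>s. fij (upd_coord y j s)))
       (at (y $ i) within {a $ i..b $ i})" by simp
    have 2: "((\<lambda>t. f (upd_coord (upd_coord y i t) j (a $ j))) has_real_derivative
        fi (upd_coord y j (a $ j))) (at (y $ i) within {a $ i..b $ i})"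
      using has_partialD[OF fi aj, of "y $ i"] y ij
      by (auto simp: upd_coord_commute[OF ij] mem_box_cart
            upd_coord_commute[OF ij, of y "y $ i" "a $ j", symmetric])
    have line: "f (upd_coord (upd_coord y i t) j (a $ j))
        + integral {a $ j..y $ j} (\<lambda>s. fj (upd_coord (upd_coord y i t) j s)) = f (upd_coord y i t)"
      if "t \<in> {a $ i..b $ i}" for t
      using ftc[OF upd_coord_in_box[OF y that]] ij by simp
    have "((\<lambda>t. f (upd_coord y i t)) has_real_derivative
       fi (upd_coord y j (a $ j)) + integral {a $ j..y $ j} (\<lambda>s. fij (upd_coord y j s)))
       (at (y $ i) within {a $ i..b $ i})"
      by (rule has_field_derivative_transform_within[OF DERIV_add[OF 2 1] zero_less_one])
         (use y line in \<open>auto simp: mem_box_cart\<close>)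
    from partial_deriv_eqI[OF this y box] show ?thesis by (simp add: fi_def)
  qed
  have line: "fi (upd_coord x j (a $ j)) + integral {a $ j..t} (\<lambda>s. fij (upd_coord x j s))
      = fi (upd_coord x j t)" if "t \<in> {a $ j..b $ j}" for t
    using deriv[OF upd_coord_in_box[OF x that]] by simp
  have "((\<lambda>t. integral {a $ j..t} (\<lambda>s. fij (upd_coord x j s))) has_real_derivative
          fij (upd_coord x j (x $ j))) (at (x $ j) within {a $ j..b $ j})"
    by (rule integral_has_real_derivative[OF cont[OF fij(2) x]]) (use x in \<open>auto simp: mem_box_cart\<close>)
  then have "((\<lambda>t. fi (upd_coord x j (a $ j)) + integral {a $ j..t} (\<lambda>s. fij (upd_coord x j s)))
      has_real_derivative fij x) (at (x $ j) within {a $ j..b $ j})"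
    using DERIV_add[OF DERIV_const[where k = "fi (upd_coord x j (a $ j))"]] by simp
  then have "((\<lambda>t. fi (upd_coord x j t)) has_real_derivative fij x) (at (x $ j) within {a $ j..b $ j})"
    by (rule has_field_derivative_transform_within[OF _ zero_less_one])
       (use x in \<open>auto simp: mem_box_cart line\<close>)
  from partial_deriv_eqI[OF this x box] show ?thesis by (simp add: fi_def fij_def fj_def)
qed

end

section \<open>Beta measures on the unit interval\<close>

text \<open>
  The finite measure with density $s^{p-1}(1-s)^{q-1}$ on $[0,1]$, for $p, q > 0$; it is not
  normalised, and its total mass is the Beta function.
\<close>

definition beta_measure :: "real \<Rightarrow> real \<Rightarrow> real measure" where
  "beta_measure p q = density (lebesgue_on {0..1}) (\<lambda>s. ennreal (s powr (p - 1) * (1 - s) powr (q - 1)))"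

lemma space_beta_measure [simp]: "space (beta_measure p q) = {0..1}"
  by (simp add: beta_measure_def)

lemma measurable_beta_measure:
  "f \<in> borel_measurable (beta_measure p q) \<longleftrightarrow> f \<in> borel_measurable (lebesgue_on {0..1})"
  by (simp add: beta_measure_def)

lemma borel_measurable_beta_measure_ident:
  "(\<lambda>s. s) \<in> borel_measurable (beta_measure p q)"
  unfolding measurable_beta_measure by (intro continuous_imp_measurable_on_sets_lebesgue) auto

lemma borel_measurable_beta_measure_continuous:
  fixes f :: "real \<Rightarrow> real"
  shows "continuous_on {0..1} f \<Longrightarrow> f \<in> borel_measurable (beta_measure p q)"
  unfolding measurable_beta_measure by (intro continuous_imp_measurable_on_sets_lebesgue) auto

lemma beta_density_measurable:
  "(\<lambda>s::real. s powr (p - 1) * (1 - s) powr (q - 1)) \<in> borel_measurable (lebesgue_on {0..1})"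
proof -
  have "(\<lambda>s::real. s powr (p - 1) * (1 - s) powr (q - 1)) \<in> borel_measurable lborel"
    unfolding measurable_lborel1 by measurable
  then show ?thesis
    by (intro measurable_restrict_space1 measurable_completion)
qed

lemma integral_beta_measure:
  fixes f :: "real \<Rightarrow> real"
  assumes "f \<in> borel_measurable (beta_measure p q)"
  shows "integral\<^sup>L (beta_measure p q) f
     = integral\<^sup>L (lebesgue_on {0..1}) (\<lambda>s. s powr (p - 1) * (1 - s) powr (q - 1) * f s)"
  using assms unfolding beta_measure_def
  by (subst integral_density) (auto simp: beta_density_measurable[unfolded beta_measure_def])

lemma integrable_beta_measure:
  fixes f :: "real \<Rightarrow> real"
  assumes "f \<in> borel_measurable (beta_measure p q)"
  shows "integrable (beta_measure p q) f
     \<longleftrightarrow> integrable (lebesgue_on {0..1}) (\<lambda>s. s powr (p - 1) * (1 - s) powr (q - 1) * f s)"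
  using assms unfolding beta_measure_def
  by (subst integrable_density) (auto simp: beta_density_measurable[unfolded beta_measure_def])

lemma integrable_beta_density:
  assumes "0 < p" "0 < q"
  shows "integrable (lebesgue_on {0..1}) (\<lambda>s::real. s powr (p - 1) * (1 - s) powr (q - 1))"
proof -
  have "(\<lambda>s::real. s powr (p - 1) * (1 - s) powr (q - 1)) absolutely_integrable_on {0..1}"
    using has_integral_Beta_real[OF assms]
    by (intro nonnegative_absolutely_integrable_1) (auto simp: integrable_on_def)
  then show ?thesis
    by (rule absolutely_integrable_imp_integrable) simp
qed

lemma finite_measure_beta_measure:
  assumes "0 < p" "0 < q"
  shows "finite_measure (beta_measure p q)"
proof
  have "emeasure (beta_measure p q) {0..1}
     = (\<integral>\<^sup>+ s. ennreal (s powr (p - 1) * (1 - s) powr (q - 1)) \<partial>lebesgue_on {0..1})"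
    unfolding beta_measure_def using beta_density_measurable
    by (subst emeasure_density) (auto intro!: nn_integral_cong simp: indicator_def)
  also have "\<dots> < \<infinity>"
    using integrable_beta_density[OF assms] by (simp add: integrable_iff_bounded)
  finally show "emeasure (beta_measure p q) (space (beta_measure p q)) \<noteq> \<infinity>" by simp
qed

lemma integrable_beta_measure_continuous:
  fixes f :: "real \<Rightarrow> real"
  assumes "0 < p" "0 < q" "continuous_on {0..1} f"
  shows "integrable (beta_measure p q) f"
proof -
  interpret finite_measure "beta_measure p q" by (rule finite_measure_beta_measure[OF assms(1,2)])
  from compact_continuous_image[OF assms(3)] have "bounded (f ` {0..1})"
    by (simp add: compact_imp_bounded)
  then obtain B where "\<forall>s\<in>{0..1}. norm (f s) \<le> B" unfolding bounded_iff by auto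
  then show ?thesis
    by (intro integrable_const_bound[of _ B] AE_I2 borel_measurable_beta_measure_continuous assms(3)) auto
qed

lemma beta_measure_shift:
  fixes f :: "real \<Rightarrow> real"
  assumes "f \<in> borel_measurable (beta_measure p q)"
  shows "(\<integral>s. s * f s \<partial>beta_measure p q) = integral\<^sup>L (beta_measure (p + 1) q) f"
proof -
  have [measurable]: "f \<in> borel_measurable (lebesgue_on {0..1})"
    "f \<in> borel_measurable (beta_measure (p+1) q)" "f \<in> borel_measurable (beta_measure p q)"
    using assms by (simp_all add: measurable_beta_measure)
  have powr: "s powr (p - 1) * (1 - s) powr (q - 1) * (s * f s) = s powr (p + 1 - 1) * (1 - s) powr (q - 1) * f s"
    if "s \<in> {0..1}" for s
    using that powr_mult_base[of s "p - 1"] by (simp add: mult_ac)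
  show ?thesis
    by (subst (1 2) integral_beta_measure) (auto intro!: Bochner_Integration.integral_cong borel_measurable_times
          borel_measurable_beta_measure_ident simp: powr)
qed

lemma has_integral_beta_measure:
  fixes f :: "real \<Rightarrow> real"
  assumes "0 < p" "0 < q" "continuous_on {0..1} f"
  shows "((\<lambda>s. s powr (p - 1) * (1 - s) powr (q - 1) * f s) has_integral
           integral\<^sup>L (beta_measure p q) f) {0..1}"
  using integrable_beta_measure_continuous[OF assms] borel_measurable_beta_measure_continuous[OF assms(3), of p q]
  by (subst integral_beta_measure) (auto intro!: has_integral_integral_lebesgue_on simp: integrable_beta_measure)

lemma beta_measure_moment:
  assumes "0 < p" "0 < q"
  shows "(\<integral>s. s ^ n \<partial>beta_measure p q) = Beta (p + real n) q"
proof -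
  have "((\<lambda>s. s powr (p - 1) * (1 - s) powr (q - 1) * s ^ n) has_integral
           integral\<^sup>L (beta_measure p q) (\<lambda>s. s ^ n)) {0..1}"
    by (intro has_integral_beta_measure assms continuous_intros)
  then have "((\<lambda>s. s powr (p + real n - 1) * (1 - s) powr (q - 1)) has_integral
           integral\<^sup>L (beta_measure p q) (\<lambda>s. s ^ n)) {0..1}"
  proof (rule has_integral_spike_finite[where S = "{0}", rotated 2])
    fix s :: real assume "s \<in> {0..1} - {0}"
    then have s: "0 < s" by auto
    have "s powr (p + real n - 1) = s powr ((p - 1) + real n)" by (simp add: algebra_simps)
    also have "\<dots> = s powr (p - 1) * s ^ n" using s by (simp only: powr_add powr_realpow)
    finally show "s powr (p + real n - 1) * (1 - s) powr (q - 1)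
        = s powr (p - 1) * (1 - s) powr (q - 1) * s ^ n" by simp
  qed simp
  from has_integral_unique[OF this has_integral_Beta_real] assms show ?thesis by simp
qed

lemma continuous_on_beta_mean:
  fixes f :: "'a::{first_countable_topology, t2_space} \<Rightarrow> real \<Rightarrow> real"
  assumes pq: "0 < p" "0 < q"
    and cont: "continuous_on (A \<times> {0..1}) (\<lambda>(x, s). f x s)"
    and bound: "\<And>x s. x \<in> A \<Longrightarrow> s \<in> {0..1} \<Longrightarrow> \<bar>f x s\<bar> \<le> B"
  shows "continuous_on A (\<lambda>x. integral\<^sup>L (beta_measure p q) (f x))"
proof -
  interpret finite_measure "beta_measure p q" by (rule finite_measure_beta_measure[OF pq])
  have meas: "f x \<in> borel_measurable (beta_measure p q)" if "x \<in> A" for x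
    by (intro borel_measurable_beta_measure_continuous
          continuous_on_compose2[OF cont, of _ "\<lambda>s. (x, s)", simplified])
       (use that in \<open>auto intro!: continuous_intros\<close>)
  show ?thesis
    unfolding continuous_on_sequentially comp_def
  proof (intro allI ballI impI; elim conjE)
    fix u x assume x: "x \<in> A" and u: "\<forall>n. u n \<in> A" "u \<longlonglongrightarrow> x"
    show "(\<lambda>n. integral\<^sup>L (beta_measure p q) (f (u n))) \<longlonglongrightarrow> integral\<^sup>L (beta_measure p q) (f x)"
    proof (rule integral_dominated_convergence[where w = "\<lambda>_. B"])
      show "AE s in beta_measure p q. (\<lambda>n. f (u n) s) \<longlonglongrightarrow> f x s"
      proof (rule AE_I2)
        fix s assume "s \<in> space (beta_measure p q)"
        then have s: "s \<in> {0..1}" by simp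
        have "continuous_on A (\<lambda>x. f x s)"
          by (intro continuous_on_compose2[OF cont, of _ "\<lambda>x. (x, s)", simplified])
             (use s in \<open>auto intro!: continuous_intros\<close>)
        then show "(\<lambda>n. f (u n) s) \<longlonglongrightarrow> f x s"
          by (rule continuous_on_tendsto_compose) (use u x in auto)
      qed
    qed (use meas x u bound in auto)
  qed
qed

lemma beta_mean_bound:
  fixes f :: "real \<Rightarrow> real"
  assumes "0 < p" "0 < q" "continuous_on {0..1} f" "\<And>s. s \<in> {0..1} \<Longrightarrow> \<bar>f s\<bar> \<le> B"
  shows "\<bar>integral\<^sup>L (beta_measure p q) f\<bar> \<le> B * Beta p q"
proof -
  have "\<bar>integral\<^sup>L (beta_measure p q) f\<bar> \<le> (\<integral>s. B * s ^ 0 \<partial>beta_measure p q)"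
    unfolding real_norm_def[symmetric]
    by (rule integral_norm_bound[THEN order_trans], rule integral_mono)
       (use assms in \<open>auto intro!: integrable_beta_measure_continuous continuous_intros\<close>)
  also have "\<dots> = B * Beta p q"
    using beta_measure_moment[OF assms(1,2), of 0] by simp
  finally show ?thesis .
qed

subsection \<open>Abel's inversion on the unit interval\<close>

lemma continuous_on_beta_mean_mult:
  fixes h :: "real \<Rightarrow> real"
  assumes "0 < p" "0 < q" "continuous_on {0..1} h"
  shows "continuous_on {0..1} (\<lambda>s. \<integral>w. h (s * w) \<partial>beta_measure p q)"
proof -
  from compact_continuous_image[OF assms(3)] have "bounded (h ` {0..1})"
    by (simp add: compact_imp_bounded)
  then obtain B where "\<forall>s\<in>{0..1}. norm (h s) \<le> B" unfolding bounded_iff by auto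
  then show ?thesis
    by (intro continuous_on_beta_mean[OF assms(1,2), where B = B])
       (auto simp: split_beta mult_le_one intro!: continuous_on_compose2[OF assms(3)] continuous_intros)
qed

text \<open>
  If \<open>s\<close> and \<open>w\<close> are independent with Beta distributions of parameters $(\alpha, 1-\alpha)$ and
  $(1, \alpha)$, then \<open>s * w\<close> has the Beta distribution of parameters $(\alpha, 1)$. The moments of the
  two sides agree, so that the claim holds for polynomials; these are dense.
\<close>

lemma beta_measure_mult:
  fixes h :: "real \<Rightarrow> real"
  assumes \<alpha>: "0 < \<alpha>" "\<alpha> < 1" and h: "continuous_on {0..1} h"
  shows "(\<integral>s. (\<integral>w. h (s * w) \<partial>beta_measure 1 \<alpha>) \<partial>beta_measure \<alpha> (1 - \<alpha>))
           = Gamma \<alpha> * Gamma (1 - \<alpha>) * integral\<^sup>L (beta_measure \<alpha> 1) h"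
proof -
  define C where "C = Gamma \<alpha> * Gamma (1 - \<alpha>)"
  define D where "D h = (\<integral>s. (\<integral>w. h (s * w) \<partial>beta_measure 1 \<alpha>) \<partial>beta_measure \<alpha> (1 - \<alpha>))
      - C * integral\<^sup>L (beta_measure \<alpha> 1) h" for h :: "real \<Rightarrow> real"
  define K where "K = Beta 1 \<alpha> * Beta \<alpha> (1 - \<alpha>) + \<bar>C\<bar> * Beta \<alpha> 1"
  have inner: "continuous_on {0..1} (\<lambda>w. f (s * w))"
    if "continuous_on {0..1} f" "s \<in> {0..1}" for f :: "real \<Rightarrow> real" and s :: real
    using that by (intro continuous_on_compose2[OF that(1)]) (auto intro!: continuous_intros mult_le_one)
  note integrable = integrable_beta_measure_continuous
  have Gamma_Suc: "Gamma (\<alpha> + real k + 1) = (\<alpha> + real k) * Gamma (\<alpha> + real k)" for k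
  proof (rule Gamma_plus1)
    show "\<alpha> + real k \<notin> \<int>\<^sub>\<le>\<^sub>0"
      using nonpos_Ints_nonpos[of "\<alpha> + real k"] \<alpha> by linarith
  qed
  have nz: "\<alpha> + real k \<noteq> 0" "Gamma (\<alpha> + real k) \<noteq> 0" "Gamma (1 + real k) \<noteq> 0" for k
    using \<alpha> Gamma_real_pos[of "\<alpha> + real k"] Gamma_real_pos[of "1 + real k"]
    by (smt (verit) of_nat_0_le_iff)+
  (* These two identities give equal moments of order k on both sides. *)
  have mono: "(\<alpha> + real k) * (Beta (1 + real k) \<alpha> * Beta (\<alpha> + real k) (1 - \<alpha>)) = C" for k
  proof -
    have "(\<alpha> + real k) * (Beta (1 + real k) \<alpha> * Beta (\<alpha> + real k) (1 - \<alpha>))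
        = (\<alpha> + real k) * (Gamma (1 + real k) * Gamma \<alpha> / Gamma (\<alpha> + real k + 1)
            * (Gamma (\<alpha> + real k) * Gamma (1 - \<alpha>) / Gamma (1 + real k)))"
      by (simp add: Beta_def add_ac)
    also have "\<dots> = C"
      using nz[of k] by (simp add: C_def Gamma_Suc)
    finally show ?thesis .
  qed
  have Beta1: "(\<alpha> + real k) * Beta (\<alpha> + real k) 1 = 1" for k
    using nz[of k] by (simp add: Beta_def Gamma_Suc)
  have poly: "D (\<lambda>v. \<Sum>k\<le>n. c k * v ^ k) = 0" for c n
  proof -
    have "(\<integral>w. (\<Sum>k\<le>n. c k * (s * w) ^ k) \<partial>beta_measure 1 \<alpha>)
            = (\<Sum>k\<le>n. (c k * Beta (1 + real k) \<alpha>) * s ^ k)" for s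
    proof -
      have "(\<integral>w. (\<Sum>k\<le>n. c k * (s * w) ^ k) \<partial>beta_measure 1 \<alpha>)
            = (\<Sum>k\<le>n. (\<integral>w. (c k * s ^ k) * w ^ k \<partial>beta_measure 1 \<alpha>))"
        using \<alpha> by (subst Bochner_Integration.integral_sum)
          (auto intro!: integrable continuous_intros simp: power_mult_distrib mult_ac)
      also have "\<dots> = (\<Sum>k\<le>n. (c k * Beta (1 + real k) \<alpha>) * s ^ k)"
        using \<alpha> by (intro sum.cong refl) (subst integral_mult_right_zero, subst beta_measure_moment, auto)
      finally show ?thesis .
    qed
    then have "(\<integral>s. (\<integral>w. (\<Sum>k\<le>n. c k * (s * w) ^ k) \<partial>beta_measure 1 \<alpha>) \<partial>beta_measure \<alpha> (1 - \<alpha>))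
        = (\<Sum>k\<le>n. (\<integral>s. (c k * Beta (1 + real k) \<alpha>) * s ^ k \<partial>beta_measure \<alpha> (1 - \<alpha>)))"
      using \<alpha> by (simp only:, subst Bochner_Integration.integral_sum)
        (auto intro!: integrable continuous_intros)
    also have "\<dots> = (\<Sum>k\<le>n. c k * (Beta (1 + real k) \<alpha> * Beta (\<alpha> + real k) (1 - \<alpha>)))"
      using \<alpha> by (intro sum.cong refl) (subst integral_mult_right_zero, subst beta_measure_moment, auto)
    also have "\<dots> = (\<Sum>k\<le>n. C * (c k * Beta (\<alpha> + real k) 1))"
    proof (intro sum.cong refl)
      fix k
      have "Beta (1 + real k) \<alpha> * Beta (\<alpha> + real k) (1 - \<alpha>)
          = ((\<alpha> + real k) * Beta (\<alpha> + real k) 1) * (Beta (1 + real k) \<alpha> * Beta (\<alpha> + real k) (1 - \<alpha>))"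
        unfolding Beta1 by simp
      also have "\<dots> = ((\<alpha> + real k) * (Beta (1 + real k) \<alpha> * Beta (\<alpha> + real k) (1 - \<alpha>)))
          * Beta (\<alpha> + real k) 1"
        by (simp only: mult_ac)
      also have "\<dots> = C * Beta (\<alpha> + real k) 1"
        unfolding mono by simp
      finally show "c k * (Beta (1 + real k) \<alpha> * Beta (\<alpha> + real k) (1 - \<alpha>)) = C * (c k * Beta (\<alpha> + real k) 1)"
        by simp
    qed
    also have "\<dots> = C * (\<Sum>k\<le>n. (\<integral>v. c k * v ^ k \<partial>beta_measure \<alpha> 1))"
      using \<alpha> unfolding sum_distrib_left
      by (intro sum.cong refl) (subst integral_mult_right_zero, subst beta_measure_moment, auto)
    also have "\<dots> = C * (\<integral>v. (\<Sum>k\<le>n. c k * v ^ k) \<partial>beta_measure \<alpha> 1)"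
      using \<alpha> by (subst Bochner_Integration.integral_sum) (auto intro!: integrable continuous_intros)
    finally show ?thesis by (simp add: D_def)
  qed
  have bound: "\<bar>D f - D g\<bar> \<le> e * K"
    if f: "continuous_on {0..1} f" and g: "continuous_on {0..1} g"
      and e: "\<And>v. v \<in> {0..1} \<Longrightarrow> \<bar>f v - g v\<bar> \<le> e" for f g e
  proof -
    have sub: "(\<integral>w. f (s * w) \<partial>beta_measure 1 \<alpha>) - (\<integral>w. g (s * w) \<partial>beta_measure 1 \<alpha>)
        = (\<integral>w. f (s * w) - g (s * w) \<partial>beta_measure 1 \<alpha>)" if "s \<in> {0..1}" for s
      using \<alpha> that by (subst Bochner_Integration.integral_diff) (auto intro!: integrable inner f g)
    have "\<bar>(\<integral>s. (\<integral>w. f (s * w) \<partial>beta_measure 1 \<alpha>) \<partial>beta_measure \<alpha> (1 - \<alpha>))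
        - (\<integral>s. (\<integral>w. g (s * w) \<partial>beta_measure 1 \<alpha>) \<partial>beta_measure \<alpha> (1 - \<alpha>))\<bar>
        = \<bar>\<integral>s. (\<integral>w. f (s * w) \<partial>beta_measure 1 \<alpha>) - (\<integral>w. g (s * w) \<partial>beta_measure 1 \<alpha>) \<partial>beta_measure \<alpha> (1 - \<alpha>)\<bar>"
      using \<alpha> by (subst Bochner_Integration.integral_diff)
        (auto intro!: integrable continuous_on_beta_mean_mult f g)
    also have "\<dots> \<le> (e * Beta 1 \<alpha>) * Beta \<alpha> (1 - \<alpha>)"
    proof (rule beta_mean_bound)
      fix s :: real assume s: "s \<in> {0..1}"
      show "\<bar>(\<integral>w. f (s * w) \<partial>beta_measure 1 \<alpha>) - (\<integral>w. g (s * w) \<partial>beta_measure 1 \<alpha>)\<bar> \<le> e * Beta 1 \<alpha>"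
        unfolding sub[OF s] using \<alpha> s
        by (intro beta_mean_bound e continuous_on_diff inner f g) (auto intro!: mult_le_one)
    qed (use \<alpha> in \<open>auto intro!: continuous_on_beta_mean_mult f g continuous_on_diff\<close>)
    finally have 1: "\<bar>(\<integral>s. (\<integral>w. f (s * w) \<partial>beta_measure 1 \<alpha>) \<partial>beta_measure \<alpha> (1 - \<alpha>))
        - (\<integral>s. (\<integral>w. g (s * w) \<partial>beta_measure 1 \<alpha>) \<partial>beta_measure \<alpha> (1 - \<alpha>))\<bar>
        \<le> (e * Beta 1 \<alpha>) * Beta \<alpha> (1 - \<alpha>)" .
    have "\<bar>C * integral\<^sup>L (beta_measure \<alpha> 1) f - C * integral\<^sup>L (beta_measure \<alpha> 1) g\<bar>
        = \<bar>C\<bar> * \<bar>integral\<^sup>L (beta_measure \<alpha> 1) (\<lambda>v. f v - g v)\<bar>"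
      using \<alpha> by (subst Bochner_Integration.integral_diff)
        (auto intro!: integrable f g simp: abs_mult[symmetric] right_diff_distrib)
    also have "\<dots> \<le> \<bar>C\<bar> * (e * Beta \<alpha> 1)"
      using \<alpha> by (intro mult_left_mono beta_mean_bound e continuous_on_diff f g) auto
    finally show ?thesis
      using 1 unfolding D_def K_def by (simp add: algebra_simps)
  qed
  have "\<bar>D h\<bar> \<le> 0"
  proof (rule field_le_epsilon)
    fix e :: real assume e: "0 < e"
    define e' where "e' = e / (\<bar>K\<bar> + 1)"
    have "0 < e'" using e by (simp add: e'_def add_nonneg_pos)
    with Stone_Weierstrass_real_polynomial_function[OF compact_Icc h]
    obtain g where g: "real_polynomial_function g" "\<And>v. v \<in> {0..1} \<Longrightarrow> \<bar>h v - g v\<bar> < e'"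
      by blast
    from g(1) obtain c n where gc: "g = (\<lambda>v. \<Sum>k\<le>n. c k * v ^ k)"
      unfolding real_polynomial_function_iff_sum by blast
    have "continuous_on {0..1} g"
      unfolding gc by (intro continuous_intros)
    then have "\<bar>D h\<bar> \<le> e' * K"
      using bound[OF h _ less_imp_le[OF g(2)]] poly[of c n, folded gc] by simp
    also have "\<dots> \<le> e' * (\<bar>K\<bar> + 1)" using \<open>0 < e'\<close> by (intro mult_left_mono) auto
    also have "\<dots> = e" by (simp add: e'_def)
    finally show "\<bar>D h\<bar> \<le> 0 + e" by simp
  qed
  then show ?thesis by (simp add: D_def C_def)
qed

text \<open>
  Times the density $v^{\alpha-1}$, the integrand is the derivative of $v^\alpha g(v)$.
\<close>

lemma beta_mean_derivative:
  assumes \<alpha>: "0 < \<alpha>"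
    and g: "\<And>v. v \<in> {0..1} \<Longrightarrow> (g has_real_derivative g' v) (at v within {0..1})"
    and g': "continuous_on {0..1} g'"
  shows "(\<integral>v. \<alpha> * g v + v * g' v \<partial>beta_measure \<alpha> 1) = g 1"
proof -
  have cg: "continuous_on {0..1} g"
    using g by (rule DERIV_continuous_on)
  have "((\<lambda>v. v powr (\<alpha> - 1) * (1 - v) powr (1 - 1) * (\<alpha> * g v + v * g' v)) has_integral
      integral\<^sup>L (beta_measure \<alpha> 1) (\<lambda>v. \<alpha> * g v + v * g' v)) {0..1}"
    using \<alpha> by (intro has_integral_beta_measure continuous_intros cg g') auto
  moreover have "((\<lambda>v. v powr (\<alpha> - 1) * (1 - v) powr (1 - 1) * (\<alpha> * g v + v * g' v)) has_integral
      1 powr \<alpha> * g 1 - 0 powr \<alpha> * g 0) {0..1}"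
  proof (rule fundamental_theorem_of_calculus_interior)
    show "continuous_on {0..1} (\<lambda>v. v powr \<alpha> * g v)"
      using \<alpha> by (intro continuous_intros cg continuous_on_powr') auto
    fix v :: real assume v: "v \<in> {0<..<1}"
    have "(g has_real_derivative g' v) (at v)"
      using g[of v] v at_within_interior[of v "{0..1}"] by (simp add: interior_atLeastAtMost_real)
    with v have "((\<lambda>v. v powr \<alpha> * g v) has_real_derivative
        (\<alpha> * v powr (\<alpha> - 1)) * g v + g' v * v powr \<alpha>) (at v)"
      by (intro DERIV_mult has_real_derivative_powr) auto
    moreover have "(\<alpha> * v powr (\<alpha> - 1)) * g v + g' v * v powr \<alpha>
        = v powr (\<alpha> - 1) * (1 - v) powr (1 - 1) * (\<alpha> * g v + v * g' v)"
      using v powr_mult_base[of v "\<alpha> - 1"] by (simp add: algebra_simps)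
    ultimately show "((\<lambda>v. v powr \<alpha> * g v) has_vector_derivative
        v powr (\<alpha> - 1) * (1 - v) powr (1 - 1) * (\<alpha> * g v + v * g' v)) (at v)"
      by (simp add: has_real_derivative_iff_has_vector_derivative)
  qed simp
  ultimately have "integral\<^sup>L (beta_measure \<alpha> 1) (\<lambda>v. \<alpha> * g v + v * g' v)
      = 1 powr \<alpha> * g 1 - 0 powr \<alpha> * g 0"
    by (rule has_integral_unique)
  then show ?thesis
    using \<alpha> by simp
qed

section \<open>Beta means of a field along a coordinate\<close>

text \<open>
  The point of parameter \<open>s\<close> on the segment, parallel to the axis \<open>j\<close>, from the lower face
  (\<open>s = 0\<close>) to \<open>x\<close> (\<open>s = 1\<close>).
\<close>

definition contract :: "real^3 \<Rightarrow> 3 \<Rightarrow> real^3 \<Rightarrow> real \<Rightarrow> real^3" where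
  "contract a j x s = upd_coord x j (a $ j + s * (x $ j - a $ j))"

text \<open>
  The integral of \<open>f\<close> over that segment against a Beta measure. Up to a constant and a power of
  $x_j - a_j$ it is the Riemann-Liouville integral of order \<open>q\<close> of $(x_j - a_j)^{p-1} f$; without that
  power it is as regular as \<open>f\<close>, up to the boundary of the box.
\<close>

definition beta_mean :: "real^3 \<Rightarrow> real \<Rightarrow> real \<Rightarrow> 3 \<Rightarrow> scalar_field \<Rightarrow> scalar_field" where
  "beta_mean a p q j f x = (\<integral>s. f (contract a j x s) \<partial>beta_measure p q)"

lemma contract_commute:
  "i \<noteq> j \<Longrightarrow> contract a i (contract a j x t) s = contract a j (contract a i x s) t"
  by (simp add: contract_def vec_eq_iff)

lemma contract_contract: "contract a j (contract a j x s) w = contract a j x (s * w)"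
  by (simp add: contract_def vec_eq_iff mult_ac)

lemma contract_1 [simp]: "contract a j x 1 = x"
  by (simp add: contract_def)

lemma continuous_on_contract [continuous_intros]:
  "continuous_on A f \<Longrightarrow> continuous_on A g \<Longrightarrow> continuous_on A (\<lambda>z. contract a j (f z) (g z))"
  unfolding contract_def by (intro continuous_intros)

lemma contract_coord_bounds:
  fixes x :: "real^3"
  assumes "x \<in> cbox a b" "s \<in> {0..1}"
  shows "a $ j + s * (x $ j - a $ j) \<in> {a $ j..b $ j}"
proof -
  have x: "a $ j \<le> x $ j" "x $ j \<le> b $ j" using assms by (auto simp: mem_box_cart)
  then have "0 \<le> s * (x $ j - a $ j)" "s * (x $ j - a $ j) \<le> x $ j - a $ j"
    using assms mult_right_mono[of s 1 "x $ j - a $ j"] by auto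
  with x show ?thesis by simp
qed

lemma contract_in_box: "x \<in> cbox a b \<Longrightarrow> s \<in> {0..1} \<Longrightarrow> contract a j x s \<in> cbox a b"
  unfolding contract_def by (intro upd_coord_in_box contract_coord_bounds)

lemma continuous_on_contract_segment:
  assumes "continuous_on (cbox a b) f" "x \<in> cbox a b"
  shows "continuous_on {0..1} (\<lambda>s. f (contract a j x s))"
  by (rule continuous_on_compose2[OF assms(1)])
     (use assms contract_in_box in \<open>auto intro!: continuous_intros\<close>)

lemma continuous_on_box_bounded:
  fixes f :: scalar_field
  assumes "continuous_on (cbox a b) f"
  shows "\<exists>B. \<forall>x\<in>cbox a b. \<bar>f x\<bar> \<le> B"
proof -
  have "bounded (f ` cbox a b)"
    by (intro compact_imp_bounded compact_continuous_image assms compact_cbox)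
  then show ?thesis unfolding bounded_iff by auto
qed

lemma beta_mean_cong:
  assumes "\<And>y. y \<in> cbox a b \<Longrightarrow> f y = g y" "x \<in> cbox a b"
  shows "beta_mean a p q j f x = beta_mean a p q j g x"
  unfolding beta_mean_def
  by (intro Bochner_Integration.integral_cong refl) (use assms contract_in_box in auto)

lemma continuous_on_beta_mean_field:
  assumes "0 < p" "0 < q" "continuous_on (cbox a b) f"
  shows "continuous_on (cbox a b) (beta_mean a p q j f)"
proof -
  obtain B where B: "\<And>x. x \<in> cbox a b \<Longrightarrow> \<bar>f x\<bar> \<le> B"
    using continuous_on_box_bounded[OF assms(3)] by blast
  show ?thesis
    unfolding beta_mean_def
    by (rule continuous_on_beta_mean[OF assms(1,2), where B = B])
       (use B contract_in_box in \<open>auto simp: split_beta intro!: continuous_on_compose2[OF assms(3)] continuous_intros\<close>)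
qed

text \<open>Differentiation under the integral sign for a finite measure.\<close>

lemma has_real_derivative_integral:
  fixes g :: "real \<Rightarrow> 'a \<Rightarrow> real"
  assumes "finite_measure M"
    and int: "\<And>t. t \<in> {c..d} \<Longrightarrow> integrable M (g t)"
    and meas: "g' t0 \<in> borel_measurable M"
    and deriv: "\<And>s t. s \<in> space M \<Longrightarrow> t \<in> {c..d} \<Longrightarrow>
                 ((\<lambda>t. g t s) has_real_derivative g' t s) (at t within {c..d})"
    and bound: "\<And>s t. s \<in> space M \<Longrightarrow> t \<in> {c..d} \<Longrightarrow> \<bar>g' t s\<bar> \<le> B"
    and t0: "t0 \<in> {c..d}"
  shows "((\<lambda>t. integral\<^sup>L M (g t)) has_real_derivative integral\<^sup>L M (g' t0)) (at t0 within {c..d})"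
  unfolding has_field_derivative_iff tendsto_at_iff_sequentially comp_def
proof (intro allI impI)
  interpret finite_measure M by fact
  fix X assume X: "\<forall>n. X n \<in> {c..d} - {t0}" "X \<longlonglongrightarrow> t0"
  have "(\<lambda>n. \<integral>s. (g (X n) s - g t0 s) / (X n - t0) \<partial>M) \<longlonglongrightarrow> integral\<^sup>L M (g' t0)"
  proof (rule integral_dominated_convergence[where w = "\<lambda>_. B"])
    show "(\<lambda>s. (g (X n) s - g t0 s) / (X n - t0)) \<in> borel_measurable M" for n
      using int[of "X n"] int[OF t0] X(1) by (auto intro!: borel_measurable_divide borel_measurable_diff)
    show "AE s in M. (\<lambda>n. (g (X n) s - g t0 s) / (X n - t0)) \<longlonglongrightarrow> g' t0 s"
    proof (rule AE_I2)
      fix s assume "s \<in> space M"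
      from deriv[OF this t0] X show "(\<lambda>n. (g (X n) s - g t0 s) / (X n - t0)) \<longlonglongrightarrow> g' t0 s"
        unfolding has_field_derivative_iff tendsto_at_iff_sequentially comp_def by blast
    qed
    show "AE s in M. norm ((g (X n) s - g t0 s) / (X n - t0)) \<le> B" for n
    proof (rule AE_I2)
      fix s assume s: "s \<in> space M"
      have "norm (g (X n) s - g t0 s) \<le> B * norm (X n - t0)"
        by (rule field_differentiable_bound[of "{c..d}" "\<lambda>t. g t s" "\<lambda>t. g' t s"])
           (use deriv[OF s] bound[OF s] X(1) t0 in auto)
      moreover have "X n \<noteq> t0" using X(1) by auto
      ultimately show "norm ((g (X n) s - g t0 s) / (X n - t0)) \<le> B"
        by (simp add: pos_divide_le_eq)
    qed
  qed (use meas in auto)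
  moreover have "(\<integral>s. (g (X n) s - g t0 s) / (X n - t0) \<partial>M)
      = (integral\<^sup>L M (g (X n)) - integral\<^sup>L M (g t0)) / (X n - t0)" for n
    using int[of "X n"] int[OF t0] X(1) by (simp add: Bochner_Integration.integral_diff)
  ultimately show "(\<lambda>n. (integral\<^sup>L M (g (X n)) - integral\<^sup>L M (g t0)) / (X n - t0)) \<longlonglongrightarrow> integral\<^sup>L M (g' t0)"
    by (simp only:)
qed

lemma has_partial_beta_mean_other:
  assumes pq: "0 < p" "0 < q" and f: "continuous_on (cbox a b) f"
    and f': "has_partial a b i f f'" "continuous_on (cbox a b) f'" and ij: "i \<noteq> j"
  shows "has_partial a b i (beta_mean a p q j f) (beta_mean a p q j f')"
  unfolding has_partial_def
proof
  fix x assume x: "x \<in> cbox a b"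
  obtain B where B: "\<And>x. x \<in> cbox a b \<Longrightarrow> \<bar>f' x\<bar> \<le> B"
    using continuous_on_box_bounded[OF f'(2)] by blast
  have comm: "contract a j (upd_coord x i t) s = upd_coord (contract a j x s) i t" for s t
    using ij by (simp add: contract_def vec_eq_iff)
  have "((\<lambda>t. \<integral>s. f (contract a j (upd_coord x i t) s) \<partial>beta_measure p q) has_real_derivative
      (\<integral>s. f' (contract a j (upd_coord x i (x $ i)) s) \<partial>beta_measure p q)) (at (x $ i) within {a $ i..b $ i})"
  proof (rule has_real_derivative_integral[OF finite_measure_beta_measure[OF pq], where B = B])
    fix t assume t: "t \<in> {a $ i..b $ i}"
    show "integrable (beta_measure p q) (\<lambda>s. f (contract a j (upd_coord x i t) s))"
      by (intro integrable_beta_measure_continuous pq continuous_on_contract_segment[where b = b]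
            f upd_coord_in_box x t)
    fix s assume s: "s \<in> space (beta_measure p q)"
    then show "((\<lambda>t. f (contract a j (upd_coord x i t) s)) has_real_derivative
        f' (contract a j (upd_coord x i t) s)) (at t within {a $ i..b $ i})"
      unfolding comm by (intro has_partialD[OF f'(1)] contract_in_box x t) auto
    show "\<bar>f' (contract a j (upd_coord x i t) s)\<bar> \<le> B"
      using s by (intro B contract_in_box upd_coord_in_box x t) auto
  qed (use x in \<open>auto simp: mem_box_cart intro!: borel_measurable_beta_measure_continuous
          continuous_on_contract_segment f'(2)\<close>)
  then show "((\<lambda>t. beta_mean a p q j f (upd_coord x i t)) has_real_derivative beta_mean a p q j f' x)
      (at (x $ i) within {a $ i..b $ i})"
    by (simp add: beta_mean_def)
qed

text \<open>Differentiation in the direction of the mean brings out a factor \<open>s\<close>, which raises \<open>p\<close> by one.\<close>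

lemma has_partial_beta_mean_same:
  assumes pq: "0 < p" "0 < q" and f: "continuous_on (cbox a b) f"
    and f': "has_partial a b j f f'" "continuous_on (cbox a b) f'"
  shows "has_partial a b j (beta_mean a p q j f) (beta_mean a (p + 1) q j f')"
  unfolding has_partial_def
proof
  fix x assume x: "x \<in> cbox a b"
  obtain B where B: "\<And>x. x \<in> cbox a b \<Longrightarrow> \<bar>f' x\<bar> \<le> B"
    using continuous_on_box_bounded[OF f'(2)] by blast
  have "((\<lambda>t. \<integral>s. f (contract a j (upd_coord x j t) s) \<partial>beta_measure p q) has_real_derivative
      (\<integral>s. s * f' (contract a j (upd_coord x j (x $ j)) s) \<partial>beta_measure p q)) (at (x $ j) within {a $ j..b $ j})"
  proof (rule has_real_derivative_integral[OF finite_measure_beta_measure[OF pq], where B = B])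
    fix t assume t: "t \<in> {a $ j..b $ j}"
    show "integrable (beta_measure p q) (\<lambda>s. f (contract a j (upd_coord x j t) s))"
      by (intro integrable_beta_measure_continuous pq continuous_on_contract_segment[where b = b]
            f upd_coord_in_box x t)
    fix s assume "s \<in> space (beta_measure p q)"
    then have s: "s \<in> {0..1}" by simp
    define r where "r t = a $ j + s * (t - a $ j)" for t
    have r: "r ` {a $ j..b $ j} \<subseteq> {a $ j..b $ j}"
    proof
      fix u assume "u \<in> r ` {a $ j..b $ j}"
      then obtain t where "t \<in> {a $ j..b $ j}" "u = r t" by auto
      with contract_coord_bounds[OF upd_coord_in_box[OF x] s, of t j j]
      show "u \<in> {a $ j..b $ j}" by (simp add: r_def)
    qed
    have "((\<lambda>u. f (upd_coord x j u)) has_real_derivative f' (upd_coord x j (r t))) (at (r t) within r ` {a $ j..b $ j})"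
      by (rule DERIV_subset[OF has_partialD[OF f'(1) x] r]) (use r t in blast)
    moreover have "(r has_real_derivative s) (at t within {a $ j..b $ j})"
      unfolding r_def by (auto intro!: derivative_eq_intros)
    ultimately have "((\<lambda>u. f (upd_coord x j u)) \<circ> r has_real_derivative f' (upd_coord x j (r t)) * s)
        (at t within {a $ j..b $ j})"
      by (rule DERIV_image_chain)
    then show "((\<lambda>t. f (contract a j (upd_coord x j t) s)) has_real_derivative
        s * f' (contract a j (upd_coord x j t) s)) (at t within {a $ j..b $ j})"
      by (simp add: contract_def r_def comp_def mult.commute)
    have "\<bar>f' (contract a j (upd_coord x j t) s)\<bar> \<le> B"
      using s by (intro B contract_in_box upd_coord_in_box x t) auto
    then show "\<bar>s * f' (contract a j (upd_coord x j t) s)\<bar> \<le> B"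
      using s mult_left_le_one_le[of "\<bar>f' (contract a j (upd_coord x j t) s)\<bar>" s] by (auto simp: abs_mult)
  qed (use x in \<open>auto simp: mem_box_cart intro!: borel_measurable_beta_measure_continuous
          continuous_on_contract_segment f'(2) continuous_intros\<close>)
  then show "((\<lambda>t. beta_mean a p q j f (upd_coord x j t)) has_real_derivative beta_mean a (p + 1) q j f' x)
      (at (x $ j) within {a $ j..b $ j})"
    by (simp add: beta_mean_def beta_measure_shift borel_measurable_beta_measure_continuous
          continuous_on_contract_segment[OF f'(2) x])
qed

text \<open>Fubini's theorem for the means along two coordinates.\<close>

lemma beta_mean_commute:
  assumes pq: "0 < p" "0 < q" "0 < p'" "0 < q'" and f: "continuous_on (cbox a b) f"
    and ij: "i \<noteq> j" and x: "x \<in> cbox a b"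
  shows "beta_mean a p q i (beta_mean a p' q' j f) x = beta_mean a p' q' j (beta_mean a p q i f) x"
proof -
  let ?M = "beta_measure p q" and ?N = "beta_measure p' q'"
  interpret M: finite_measure ?M by (rule finite_measure_beta_measure[OF pq(1,2)])
  interpret N: finite_measure ?N by (rule finite_measure_beta_measure[OF pq(3,4)])
  interpret P: pair_sigma_finite ?N ?M ..
  interpret NM: finite_measure "?N \<Otimes>\<^sub>M ?M"
    by (rule finite_measure_pair_measure) (rule M.finite_measure_axioms N.finite_measure_axioms)+
  obtain B where B: "\<And>x. x \<in> cbox a b \<Longrightarrow> \<bar>f x\<bar> \<le> B"
    using continuous_on_box_bounded[OF f] by blast
  (* Clamping to the box extends f continuously, which gives joint measurability. *)
  define F where "F = (\<lambda>t s. f (clamp a b (contract a j (contract a i x s) t)))"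
  have in_box: "contract a j (contract a i x s) t \<in> cbox a b" if "s \<in> {0..1}" "t \<in> {0..1}" for s t
    by (intro contract_in_box x that)
  have "(\<lambda>z. f (clamp a b (contract a j (contract a i x (snd z)) (fst z)))) \<in> borel_measurable (borel \<Otimes>\<^sub>M borel)"
    unfolding borel_prod
    by (intro borel_measurable_continuous_onI continuous_on_compose2[OF clamp_continuous_on[OF f]]
          continuous_intros) auto
  moreover have "(\<lambda>z. (fst z, snd z)) \<in> ?N \<Otimes>\<^sub>M ?M \<rightarrow>\<^sub>M borel \<Otimes>\<^sub>M borel"
    by (intro measurable_Pair measurable_compose[OF measurable_fst borel_measurable_beta_measure_ident]
          measurable_compose[OF measurable_snd borel_measurable_beta_measure_ident])
  ultimately have "case_prod F \<in> borel_measurable (?N \<Otimes>\<^sub>M ?M)"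
    unfolding F_def split_beta by (auto dest: measurable_compose)
  then have "integrable (?N \<Otimes>\<^sub>M ?M) (case_prod F)"
    by (intro NM.integrable_const_bound[of _ B] AE_I2)
       (auto simp: F_def space_pair_measure in_box clamp_cancel_cbox B)
  from P.Fubini_integral[OF this]
  have "(\<integral>s. (\<integral>t. F t s \<partial>?N) \<partial>?M) = (\<integral>t. (\<integral>s. F t s \<partial>?M) \<partial>?N)" .
  moreover have "(\<integral>s. (\<integral>t. F t s \<partial>?N) \<partial>?M) = beta_mean a p q i (beta_mean a p' q' j f) x"
    unfolding beta_mean_def F_def
    by (intro Bochner_Integration.integral_cong refl) (simp add: in_box clamp_cancel_cbox)
  moreover have "(\<integral>t. (\<integral>s. F t s \<partial>?M) \<partial>?N) = beta_mean a p' q' j (beta_mean a p q i f) x"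
    unfolding beta_mean_def F_def
    by (intro Bochner_Integration.integral_cong refl)
       (simp add: in_box clamp_cancel_cbox contract_commute[OF ij])
  ultimately show ?thesis by simp
qed

text \<open>
  The regular factor of a Riemann-Liouville derivative: for \<open>h\<close> of class $C^1$, the derivative of
  order $1-\alpha$ of \<open>h\<close> in the coordinate \<open>j\<close> is $(x_j - a_j)^{\alpha-1}$ times this function
  off the lower face.
\<close>

definition deriv_mean :: "real^3 \<Rightarrow> real^3 \<Rightarrow> real \<Rightarrow> 3 \<Rightarrow> scalar_field \<Rightarrow> scalar_field" where
  "deriv_mean a b \<alpha> j h x = 1 / Gamma \<alpha> * (\<alpha> * beta_mean a 1 \<alpha> j h x
     + (x $ j - a $ j) * beta_mean a 2 \<alpha> j (partial_deriv a b j h) x)"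

context
  fixes a b :: "real^3"
  assumes box: "\<And>j. a $ j < b $ j"
begin

lemma Ck_on_box_beta_mean:
  "0 < p \<Longrightarrow> 0 < q \<Longrightarrow> Ck_on_box k a b f \<Longrightarrow> Ck_on_box k a b (beta_mean a p q j f)"
proof (induction k arbitrary: f p)
  case 0
  then show ?case by (simp add: continuous_on_beta_mean_field)
next
  case (Suc k)
  note f = Ck_on_box_SucD[OF box Suc.prems(3)]
  note cont = Ck_on_box_imp_continuous[OF Suc.prems(3)] Ck_on_box_imp_continuous[OF f(2)]
  show ?case
  proof (rule Ck_on_box_SucI[OF box])
    show "continuous_on (cbox a b) (beta_mean a p q j f)"
      by (intro continuous_on_beta_mean_field Suc.prems cont)
    show "has_partial a b i (beta_mean a p q j f)
        (beta_mean a (if i = j then p + 1 else p) q j (partial_deriv a b i f))" for i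
      using has_partial_beta_mean_same[OF Suc.prems(1,2) cont(1) f(1) cont(2)]
        has_partial_beta_mean_other[OF Suc.prems(1,2) cont(1) f(1) cont(2)] by auto
    show "Ck_on_box k a b (beta_mean a (if i = j then p + 1 else p) q j (partial_deriv a b i f))" for i
      using Suc.prems f(2) by (intro Suc.IH) auto
  qed
qed

lemma Ck_on_box_deriv_mean:
  assumes "0 < \<alpha>" "Ck_on_box (Suc k) a b h"
  shows "Ck_on_box k a b (deriv_mean a b \<alpha> j h)"
proof -
  have "Ck_on_box k a b (beta_mean a 1 \<alpha> j h)"
    "Ck_on_box k a b (beta_mean a 2 \<alpha> j (partial_deriv a b j h))"
    using assms Ck_on_box_Suc_imp[OF box] Ck_on_box_SucD(2)[OF box]
    by (auto intro!: Ck_on_box_beta_mean simp del: Ck_on_box.simps)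
  then show ?thesis
    unfolding deriv_mean_def
    by (intro Ck_on_box_cmult Ck_on_box_add Ck_on_box_coord_mult box)
qed

lemma has_partial_deriv_mean:
  assumes \<alpha>: "0 < \<alpha>" and h: "Ck_on_box (Suc (Suc 0)) a b h" and ij: "i \<noteq> j"
  shows "has_partial a b i (deriv_mean a b \<alpha> j h) (deriv_mean a b \<alpha> j (partial_deriv a b i h))"
proof -
  note h1 = Ck_on_box_SucD[OF box h]
  note h2 = Ck_on_box_SucD[OF box h1(2)]
  have cont: "continuous_on (cbox a b) h" "continuous_on (cbox a b) (partial_deriv a b l h)"
    "continuous_on (cbox a b) (partial_deriv a b m (partial_deriv a b l h))" for l m
    using h h1(2) h2(2) Ck_on_box_imp_continuous by blast+
  have comm: "beta_mean a 2 \<alpha> j (partial_deriv a b i (partial_deriv a b j h)) x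
      = beta_mean a 2 \<alpha> j (partial_deriv a b j (partial_deriv a b i h)) x" if "x \<in> cbox a b" for x
    by (rule beta_mean_cong[OF partial_deriv_commute[OF box h ij] that])
  have "has_partial a b i (\<lambda>x. 1 / Gamma \<alpha> * (\<alpha> * beta_mean a 1 \<alpha> j h x
     + (x $ j - a $ j) * beta_mean a 2 \<alpha> j (partial_deriv a b j h) x))
    (\<lambda>x. 1 / Gamma \<alpha> * (\<alpha> * beta_mean a 1 \<alpha> j (partial_deriv a b i h) x
     + ((x $ j - a $ j) * beta_mean a 2 \<alpha> j (partial_deriv a b i (partial_deriv a b j h)) x
         + (if i = j then 1 else 0) * beta_mean a 2 \<alpha> j (partial_deriv a b j h) x)))"
    by (intro has_partial_cmult has_partial_add has_partial_coord_mult has_partial_beta_mean_other box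
          h1(1) h2(1) cont ij) (use \<alpha> in auto)
  then show ?thesis
    unfolding deriv_mean_def
    by (rule has_partial_cong)
       (use ij comm in auto)
qed

text \<open>
  Abel's inversion. On the segment through \<open>x\<close>, the value of \<open>deriv_mean\<close> at the point of parameter
  \<open>s\<close> is a mean of $\alpha g(s w) + s w\, g'(s w)$ over \<open>w\<close>, with \<open>g\<close> the restriction of \<open>h\<close>.
\<close>

lemma beta_mean_deriv_mean:
  assumes \<alpha>: "0 < \<alpha>" "\<alpha> < 1" and h: "Ck_on_box (Suc 0) a b h" and x: "x \<in> cbox a b"
  shows "beta_mean a \<alpha> (1 - \<alpha>) j (deriv_mean a b \<alpha> j h) x = Gamma (1 - \<alpha>) * h x"
proof -
  define g where "g v = h (contract a j x v)" for v
  define g' where "g' v = (x $ j - a $ j) * partial_deriv a b j h (contract a j x v)" for v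
  note h1 = Ck_on_box_SucD[OF box h]
  note cont = Ck_on_box_imp_continuous[OF h] Ck_on_box_imp_continuous[OF h1(2)]
  have cg: "continuous_on {0..1} g" "continuous_on {0..1} g'"
    unfolding g_def g'_def by (intro continuous_intros continuous_on_contract_segment[where b = b] cont x)+
  have deriv: "(g has_real_derivative g' v) (at v within {0..1})" if v: "v \<in> {0..1}" for v
  proof -
    define r where "r v = a $ j + v * (x $ j - a $ j)" for v
    have r: "r ` {0..1} \<subseteq> {a $ j..b $ j}"
      using contract_coord_bounds[OF x, of _ j] by (auto simp: r_def)
    have "((\<lambda>u. h (upd_coord x j u)) has_real_derivative partial_deriv a b j h (upd_coord x j (r v)))
        (at (r v) within r ` {0..1})"
      by (rule DERIV_subset[OF has_partialD[OF h1(1) x] r]) (use r v in blast)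
    moreover have "(r has_real_derivative (x $ j - a $ j)) (at v within {0..1})"
      unfolding r_def by (auto intro!: derivative_eq_intros)
    ultimately have "((\<lambda>u. h (upd_coord x j u)) \<circ> r has_real_derivative
        partial_deriv a b j h (upd_coord x j (r v)) * (x $ j - a $ j)) (at v within {0..1})"
      by (rule DERIV_image_chain)
    then show ?thesis
      by (simp add: g_def[abs_def] g'_def contract_def r_def comp_def mult.commute)
  qed
  have inner: "deriv_mean a b \<alpha> j h (contract a j x s)
      = 1 / Gamma \<alpha> * (\<integral>w. \<alpha> * g (s * w) + (s * w) * g' (s * w) \<partial>beta_measure 1 \<alpha>)"
    if s: "s \<in> {0..1}" for s
  proof -
    have sw: "continuous_on {0..1} (\<lambda>w. f (s * w))" if "continuous_on {0..1} f" for f :: "real \<Rightarrow> real"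
      using s that by (intro continuous_on_compose2[OF that]) (auto intro!: continuous_intros mult_le_one)
    have "(\<integral>w. \<alpha> * g (s * w) + (s * w) * g' (s * w) \<partial>beta_measure 1 \<alpha>)
        = \<alpha> * (\<integral>w. g (s * w) \<partial>beta_measure 1 \<alpha>) + s * (\<integral>w. w * g' (s * w) \<partial>beta_measure 1 \<alpha>)"
      using \<alpha> unfolding mult.assoc
      by (subst Bochner_Integration.integral_add)
         (auto intro!: integrable_beta_measure_continuous continuous_intros sw cg)
    also have "(\<integral>w. w * g' (s * w) \<partial>beta_measure 1 \<alpha>) = (\<integral>w. g' (s * w) \<partial>beta_measure 2 \<alpha>)"
      using beta_measure_shift[OF borel_measurable_beta_measure_continuous[OF sw[OF cg(2)]], of 1 \<alpha>] by simp
    also have "s * (\<integral>w. g' (s * w) \<partial>beta_measure 2 \<alpha>)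
        = s * (x $ j - a $ j) * beta_mean a 2 \<alpha> j (partial_deriv a b j h) (contract a j x s)"
      by (simp add: g'_def beta_mean_def contract_contract)
    also have "(\<integral>w. g (s * w) \<partial>beta_measure 1 \<alpha>) = beta_mean a 1 \<alpha> j h (contract a j x s)"
      by (simp add: g_def beta_mean_def contract_contract)
    finally show ?thesis
      by (simp add: deriv_mean_def contract_def)
  qed
  have "beta_mean a \<alpha> (1 - \<alpha>) j (deriv_mean a b \<alpha> j h) x
      = (\<integral>s. 1 / Gamma \<alpha> * (\<integral>w. \<alpha> * g (s * w) + (s * w) * g' (s * w) \<partial>beta_measure 1 \<alpha>) \<partial>beta_measure \<alpha> (1 - \<alpha>))"
    unfolding beta_mean_def by (intro Bochner_Integration.integral_cong refl inner) simp
  also have "\<dots> = 1 / Gamma \<alpha> * (\<integral>s. (\<integral>w. \<alpha> * g (s * w) + (s * w) * g' (s * w) \<partial>beta_measure 1 \<alpha>) \<partial>beta_measure \<alpha> (1 - \<alpha>))"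
    by (rule integral_mult_right_zero)
  also have "(\<integral>s. (\<integral>w. \<alpha> * g (s * w) + (s * w) * g' (s * w) \<partial>beta_measure 1 \<alpha>) \<partial>beta_measure \<alpha> (1 - \<alpha>))
      = Gamma \<alpha> * Gamma (1 - \<alpha>) * (\<integral>v. \<alpha> * g v + v * g' v \<partial>beta_measure \<alpha> 1)"
    by (rule beta_measure_mult[OF \<alpha>, where h = "\<lambda>v. \<alpha> * g v + v * g' v"]) (intro continuous_intros cg)
  also have "(\<integral>v. \<alpha> * g v + v * g' v \<partial>beta_measure \<alpha> 1) = h x"
    using beta_mean_derivative[OF \<alpha>(1) deriv cg(2)] by (simp add: g_def)
  finally show ?thesis
    using Gamma_real_pos[OF \<alpha>(1)] by simp
qed

end

section \<open>Fractional operators on the half-open box\<close>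

text \<open>
  The points of the box that lie on no lower face. Riemann-Liouville derivatives are singular on
  the lower faces, and both fractional integrals and one-sided derivatives at a point of the
  half-open box depend only on the values there.
\<close>

definition half_open_box :: "real^3 \<Rightarrow> real^3 \<Rightarrow> (real^3) set" where
  "half_open_box a b = {x \<in> cbox a b. \<forall>j. a $ j < x $ j}"

text \<open>Equality of fields away from the lower faces.\<close>

definition agree :: "real^3 \<Rightarrow> real^3 \<Rightarrow> scalar_field \<Rightarrow> scalar_field \<Rightarrow> bool" where
  "agree a b f g \<longleftrightarrow> (\<forall>x\<in>half_open_box a b. f x = g x)"

text \<open>The weight $\prod_j (x_j - a_j)^{p_j - 1}$, and the same product without the factor of index \<open>j\<close>.\<close>

definition weight :: "real^3 \<Rightarrow> (3 \<Rightarrow> real) \<Rightarrow> scalar_field" where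
  "weight a p x = (\<Prod>i\<in>UNIV. (x $ i - a $ i) powr (p i - 1))"

definition weight_off :: "real^3 \<Rightarrow> (3 \<Rightarrow> real) \<Rightarrow> 3 \<Rightarrow> scalar_field" where
  "weight_off a p j x = (\<Prod>i\<in>UNIV - {j}. (x $ i - a $ i) powr (p i - 1))"

text \<open>
  The class on which the fractional operators act: off the lower faces, \<open>f\<close> is the weight with
  positive exponents \<open>p\<close> times a function of class $C^k$ on the closed box.
\<close>

definition weighted :: "real^3 \<Rightarrow> real^3 \<Rightarrow> nat \<Rightarrow> (3 \<Rightarrow> real) \<Rightarrow> scalar_field \<Rightarrow> bool" where
  "weighted a b k p f \<longleftrightarrow> (\<forall>i. 0 < p i) \<and>
     (\<exists>h. Ck_on_box k a b h \<and> agree a b f (\<lambda>x. weight a p x * h x))"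

lemma agreeD: "agree a b f g \<Longrightarrow> x \<in> half_open_box a b \<Longrightarrow> f x = g x"
  by (simp add: agree_def)

lemma agree_trans [trans]: "agree a b f g \<Longrightarrow> agree a b g h \<Longrightarrow> agree a b f h"
  by (simp add: agree_def)

lemma agree_sym: "agree a b f g \<Longrightarrow> agree a b g f"
  by (simp add: agree_def)

lemma half_open_box_imp_box: "x \<in> half_open_box a b \<Longrightarrow> x \<in> cbox a b"
  by (simp add: half_open_box_def)

lemma half_open_boxD: "x \<in> half_open_box a b \<Longrightarrow> a $ j < x $ j" "x \<in> half_open_box a b \<Longrightarrow> x $ j \<le> b $ j"
  by (auto simp: half_open_box_def mem_box_cart)

lemma upd_coord_half_open:
  "x \<in> half_open_box a b \<Longrightarrow> a $ j < t \<Longrightarrow> t \<le> b $ j \<Longrightarrow> upd_coord x j t \<in> half_open_box a b"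
  by (auto simp: half_open_box_def mem_box_cart)

lemma weight_split: "weight a p x = (x $ j - a $ j) powr (p j - 1) * weight_off a p j x"
  unfolding weight_def weight_off_def by (rule prod.remove) auto

lemma weight_off_upd_coord [simp]: "weight_off a p j (upd_coord x j t) = weight_off a p j x"
  unfolding weight_off_def by (intro prod.cong) auto

lemma weight_off_fun_upd [simp]: "weight_off a (p(j := c)) j x = weight_off a p j x"
  unfolding weight_off_def by (intro prod.cong) auto

lemma weight_upd_coord:
  "weight a p (upd_coord x j t) = (t - a $ j) powr (p j - 1) * weight_off a p j x"
  by (simp add: weight_split[of a p _ j])

lemma weight_one: "x \<in> half_open_box a b \<Longrightarrow> weight a (\<lambda>_. 1) x = 1"
proof -
  assume "x \<in> half_open_box a b"
  then have "x $ i - a $ i \<noteq> 0" for i using half_open_boxD(1)[of x a b i] by simp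
  then show ?thesis by (simp add: weight_def)
qed

subsection \<open>Locality\<close>

lemma rl_integral_cong:
  assumes "agree a b f g"
  shows "agree a b (rl_integral a \<beta> j f) (rl_integral a \<beta> j g)"
  unfolding agree_def
proof
  fix x assume x: "x \<in> half_open_box a b"
  have "integral {a $ j..x $ j} (\<lambda>t. f (upd_coord x j t) / (x $ j - t) powr (1 - \<beta>))
      = integral {a $ j..x $ j} (\<lambda>t. g (upd_coord x j t) / (x $ j - t) powr (1 - \<beta>))"
  proof (rule integral_spike[of "{a $ j}"])
    fix t assume t: "t \<in> {a $ j..x $ j} - {a $ j}"
    then have "a $ j < t" "t \<le> b $ j" using half_open_boxD(2)[OF x, of j] by auto
    from agreeD[OF assms upd_coord_half_open[OF x this]]
    show "g (upd_coord x j t) / (x $ j - t) powr (1 - \<beta>) = f (upd_coord x j t) / (x $ j - t) powr (1 - \<beta>)"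
      by simp
  qed simp
  then show "rl_integral a \<beta> j f x = rl_integral a \<beta> j g x"
    by (simp add: rl_integral_def)
qed

lemma has_derivative_line_cong:
  assumes "agree a b f g" "x \<in> half_open_box a b"
    and "((\<lambda>t. f (upd_coord x j t)) has_vector_derivative D) (at (x $ j) within {a $ j..b $ j})"
  shows "((\<lambda>t. g (upd_coord x j t)) has_vector_derivative D) (at (x $ j) within {a $ j..b $ j})"
proof (rule has_vector_derivative_transform_within[OF assms(3), of "x $ j - a $ j"])
  fix t assume "t \<in> {a $ j..b $ j}" "dist t (x $ j) < x $ j - a $ j"
  then have "a $ j < t" "t \<le> b $ j" by (auto simp: dist_real_def)
  from agreeD[OF assms(1) upd_coord_half_open[OF assms(2) this]]
  show "f (upd_coord x j t) = g (upd_coord x j t)" .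
qed (use half_open_boxD[OF assms(2), of j] in auto)

lemma partial_deriv_cong:
  assumes "agree a b f g"
  shows "agree a b (partial_deriv a b j f) (partial_deriv a b j g)"
  unfolding agree_def
proof
  fix x assume x: "x \<in> half_open_box a b"
  have "(\<lambda>D. ((\<lambda>t. f (upd_coord x j t)) has_vector_derivative D) (at (x $ j) within {a $ j..b $ j}))
      = (\<lambda>D. ((\<lambda>t. g (upd_coord x j t)) has_vector_derivative D) (at (x $ j) within {a $ j..b $ j}))"
    using has_derivative_line_cong[OF assms x] has_derivative_line_cong[OF agree_sym[OF assms] x] by blast
  then show "partial_deriv a b j f x = partial_deriv a b j g x"
    by (simp add: partial_deriv_def vector_derivative_def)
qed

lemma rl_deriv_eq:
  assumes "0 < \<alpha>" "\<alpha> < 1"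
  shows "rl_deriv a b (1 - \<alpha>) j f = partial_deriv a b j (rl_integral a \<alpha> j f)"
proof -
  have "\<lfloor>1 - \<alpha>\<rfloor> = 0" using assms by (simp add: floor_eq_iff)
  then show ?thesis by (simp add: rl_deriv_def frac_order_def)
qed

lemma caputo_deriv_eq:
  assumes "0 < \<alpha>" "\<alpha> < 1"
  shows "caputo_deriv a b \<alpha> j f = rl_integral a (1 - \<alpha>) j (partial_deriv a b j f)"
proof -
  have "\<lfloor>\<alpha>\<rfloor> = 0" using assms by (simp add: floor_eq_iff)
  then show ?thesis by (simp add: caputo_deriv_def frac_order_def)
qed

subsection \<open>Riemann-Liouville integrals of weighted functions\<close>

text \<open>
  Substituting $t = a_j + s\,(x_j - a_j)$ turns the kernel and the weight into the density of a Beta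
  measure; the two end points, where kernel and weight may be singular, are negligible.
\<close>

lemma has_integral_weighted:
  assumes h: "continuous_on (cbox a b) h" and f: "agree a b f (\<lambda>x. weight a p x * h x)"
    and p: "0 < p j" and \<beta>: "0 < \<beta>" and x: "x \<in> half_open_box a b"
  shows "((\<lambda>t. f (upd_coord x j t) / (x $ j - t) powr (1 - \<beta>)) has_integral
           (x $ j - a $ j) powr (p j + \<beta> - 1) * weight_off a p j x * beta_mean a (p j) \<beta> j h x)
         {a $ j..x $ j}"
proof -
  define L where "L = x $ j - a $ j"
  have L: "0 < L" using half_open_boxD(1)[OF x, of j] by (simp add: L_def)
  define F where "F s = s powr (p j - 1) * (1 - s) powr (\<beta> - 1) * h (contract a j x s)" for s
  define C where "C = L powr (p j - 1) * L powr (\<beta> - 1) * weight_off a p j x"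
  have "(F has_integral beta_mean a (p j) \<beta> j h x) (cbox 0 1)"
    unfolding F_def beta_mean_def cbox_interval
    by (intro has_integral_beta_measure p \<beta> continuous_on_contract_segment[OF h half_open_box_imp_box[OF x]])
  from has_integral_affinity[OF this, of "1 / L" "- (a $ j / L)"]
  have "((\<lambda>t. F ((1 / L) *\<^sub>R t + - (a $ j / L))) has_integral L * beta_mean a (p j) \<beta> j h x)
      ((\<lambda>s. L * s + a $ j) ` {0..1})"
    using L by (simp add: cbox_interval)
  also have "(\<lambda>s. L * s + a $ j) ` {0..1} = {a $ j..x $ j}"
    using L image_affinity_atLeastAtMost[of L "a $ j" 0 1] by (simp add: L_def)
  finally have "((\<lambda>t. C * F ((1 / L) *\<^sub>R t + - (a $ j / L))) has_integral
      C * (L * beta_mean a (p j) \<beta> j h x)) {a $ j..x $ j}"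
    by (rule has_integral_mult_right)
  also have "C * (L * beta_mean a (p j) \<beta> j h x)
      = (x $ j - a $ j) powr (p j + \<beta> - 1) * weight_off a p j x * beta_mean a (p j) \<beta> j h x"
  proof -
    have "L powr (p j + \<beta> - 1) = L powr ((p j - 1) + (\<beta> - 1) + 1)" by (simp add: algebra_simps)
    also have "\<dots> = L powr (p j - 1) * L powr (\<beta> - 1) * L" using L by (simp only: powr_add powr_one)
    finally show ?thesis by (simp add: C_def L_def)
  qed
  finally show ?thesis
  proof (rule has_integral_spike_finite[where S = "{a $ j, x $ j}", rotated 2])
    fix t assume "t \<in> {a $ j..x $ j} - {a $ j, x $ j}"
    then have t: "a $ j < t" "t < x $ j" "t \<le> b $ j" using half_open_boxD(2)[OF x, of j] by auto
    define s where "s = (t - a $ j) / L"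
    have s1: "(1 / L) *\<^sub>R t + - (a $ j / L) = s"
      by (simp add: s_def diff_divide_distrib)
    have "x $ j - t = L - (t - a $ j)" by (simp add: L_def)
    then have s2: "1 - s = (x $ j - t) / L"
      using L by (simp only: s_def diff_divide_distrib[of L]) simp
    have e0: "contract a j x s = upd_coord x j t"
      using L by (simp add: contract_def s_def L_def)
    have e1: "s powr (p j - 1) * L powr (p j - 1) = (t - a $ j) powr (p j - 1)"
      using t L by (simp add: s_def powr_divide)
    have e2: "(1 - s) powr (\<beta> - 1) * L powr (\<beta> - 1) = 1 / (x $ j - t) powr (1 - \<beta>)"
      using t L powr_minus_divide[of "x $ j - t" "1 - \<beta>"] by (simp add: s2 powr_divide)
    have "C * F s = (s powr (p j - 1) * L powr (p j - 1)) * ((1 - s) powr (\<beta> - 1) * L powr (\<beta> - 1))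
        * weight_off a p j x * h (contract a j x s)"
      by (simp only: C_def F_def mult_ac)
    also have "\<dots> = (t - a $ j) powr (p j - 1) * weight_off a p j x * h (upd_coord x j t)
        / (x $ j - t) powr (1 - \<beta>)"
      unfolding e0 e1 e2 by simp
    also have "\<dots> = f (upd_coord x j t) / (x $ j - t) powr (1 - \<beta>)"
      using agreeD[OF f upd_coord_half_open[OF x t(1,3)]] by (simp add: weight_upd_coord)
    finally show "f (upd_coord x j t) / (x $ j - t) powr (1 - \<beta>) = C * F ((1 / L) *\<^sub>R t + - (a $ j / L))"
      unfolding s1 by simp
  qed simp
qed

lemma rl_integral_weighted:
  assumes "continuous_on (cbox a b) h" "agree a b f (\<lambda>x. weight a p x * h x)" "0 < p j" "0 < \<beta>"
  shows "agree a b (rl_integral a \<beta> j f)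
           (\<lambda>x. weight a (p(j := p j + \<beta>)) x * (1 / Gamma \<beta> * beta_mean a (p j) \<beta> j h x))"
  unfolding agree_def rl_integral_def
  using integral_unique[OF has_integral_weighted[OF assms]]
  by (simp add: weight_split[of a "p(j := p j + \<beta>)" _ j])

lemma rl_integral_add:
  assumes "(\<lambda>t. f (upd_coord x j t) / (x $ j - t) powr (1 - \<beta>)) integrable_on {a $ j..x $ j}"
    and "(\<lambda>t. g (upd_coord x j t) / (x $ j - t) powr (1 - \<beta>)) integrable_on {a $ j..x $ j}"
  shows "rl_integral a \<beta> j (\<lambda>y. f y + g y) x = rl_integral a \<beta> j f x + rl_integral a \<beta> j g x"
  unfolding rl_integral_def add_divide_distrib
  using Henstock_Kurzweil_Integration.integral_add[OF assms] by (simp add: distrib_left)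

lemma rl_integral_uminus: "rl_integral a \<beta> j (\<lambda>y. - f y) = (\<lambda>x. - rl_integral a \<beta> j f x)"
  by (simp add: rl_integral_def)

lemma weighted_integrable:
  assumes "weighted a b k p f" "0 < \<beta>" "x \<in> half_open_box a b"
  shows "(\<lambda>t. f (upd_coord x j t) / (x $ j - t) powr (1 - \<beta>)) integrable_on {a $ j..x $ j}"
  using assms has_integral_weighted[of a b _ f p j \<beta> x] Ck_on_box_imp_continuous
  unfolding weighted_def integrable_on_def by blast

lemma rl_integral_add_weighted:
  assumes "weighted a b k p f" "weighted a b l q g" "0 < \<beta>"
  shows "agree a b (rl_integral a \<beta> j (\<lambda>y. f y + g y)) (\<lambda>x. rl_integral a \<beta> j f x + rl_integral a \<beta> j g x)"
  unfolding agree_def using weighted_integrable assms by (intro ballI rl_integral_add) blast+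

lemma rl_integral_add3_weighted:
  assumes "weighted a b k p f" "weighted a b l q g" "weighted a b m r h" "0 < \<beta>"
  shows "agree a b (rl_integral a \<beta> j (\<lambda>y. f y + g y + h y))
           (\<lambda>x. rl_integral a \<beta> j f x + rl_integral a \<beta> j g x + rl_integral a \<beta> j h x)"
  unfolding agree_def
proof
  fix x assume x: "x \<in> half_open_box a b"
  note int = weighted_integrable[OF assms(1,4) x, of j] weighted_integrable[OF assms(2,4) x, of j]
    weighted_integrable[OF assms(3,4) x, of j]
  have "(\<lambda>t. (f (upd_coord x j t) + g (upd_coord x j t)) / (x $ j - t) powr (1 - \<beta>)) integrable_on {a $ j..x $ j}"
    unfolding add_divide_distrib by (intro Henstock_Kurzweil_Integration.integrable_add int)
  from rl_integral_add[OF this int(3)] rl_integral_add[OF int(1,2)]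
  show "rl_integral a \<beta> j (\<lambda>y. f y + g y + h y) x
      = rl_integral a \<beta> j f x + rl_integral a \<beta> j g x + rl_integral a \<beta> j h x"
    by simp
qed

lemma weighted_one: "Ck_on_box k a b f \<Longrightarrow> weighted a b k (\<lambda>_. 1) f"
  unfolding weighted_def by (auto simp: agree_def weight_one)

lemma weighted_uminus:
  assumes "weighted a b 0 p f"
  shows "weighted a b 0 p (\<lambda>x. - f x)"
proof -
  from assms obtain h where "\<forall>i. 0 < p i" "continuous_on (cbox a b) h" "agree a b f (\<lambda>x. weight a p x * h x)"
    unfolding weighted_def by auto
  then show ?thesis
    unfolding weighted_def
    by (intro conjI exI[of _ "\<lambda>x. - h x"]) (auto simp: agree_def intro!: continuous_intros)
qed

context
  fixes a b :: "real^3"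
  assumes box: "\<And>j. a $ j < b $ j"
begin

lemma weighted_rl_integral:
  assumes "weighted a b k p f" "0 < \<beta>"
  shows "weighted a b k (p(j := p j + \<beta>)) (rl_integral a \<beta> j f)"
proof -
  from assms obtain h where p: "\<And>i. 0 < p i" and h: "Ck_on_box k a b h"
    and f: "agree a b f (\<lambda>x. weight a p x * h x)"
    unfolding weighted_def by auto
  have "Ck_on_box k a b (\<lambda>x. 1 / Gamma \<beta> * beta_mean a (p j) \<beta> j h x)"
    by (intro Ck_on_box_cmult Ck_on_box_beta_mean box p assms h)
  with rl_integral_weighted[OF Ck_on_box_imp_continuous[OF h] f p assms(2)] p assms(2)
  show ?thesis
    unfolding weighted_def by (auto simp: add_pos_pos)
qed

lemma rl_integral_commute:
  assumes f: "weighted a b k p f" and ij: "i \<noteq> j" and \<beta>: "0 < \<beta>" "0 < \<gamma>"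
  shows "agree a b (rl_integral a \<beta> i (rl_integral a \<gamma> j f)) (rl_integral a \<gamma> j (rl_integral a \<beta> i f))"
proof -
  from f obtain h where p: "\<And>i. 0 < p i" and h: "continuous_on (cbox a b) h"
    and f: "agree a b f (\<lambda>x. weight a p x * h x)"
    unfolding weighted_def using Ck_on_box_imp_continuous by blast
  have *: "agree a b (rl_integral a \<beta> i (rl_integral a \<gamma> j f))
     (\<lambda>x. weight a (p(j := p j + \<gamma>, i := p i + \<beta>)) x *
       (1 / Gamma \<beta> * (1 / Gamma \<gamma> * beta_mean a (p i) \<beta> i (beta_mean a (p j) \<gamma> j h) x)))"
    if ij: "i \<noteq> j" and \<beta>: "0 < \<beta>" "0 < \<gamma>" for i j \<beta> \<gamma>
  proof -
    have "continuous_on (cbox a b) (\<lambda>x. 1 / Gamma \<gamma> * beta_mean a (p j) \<gamma> j h x)"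
      by (intro continuous_intros continuous_on_beta_mean_field h p \<beta>)
    from rl_integral_weighted[OF this rl_integral_weighted[OF h f p \<beta>(2)], of i \<beta>] p[of i] \<beta>(1) ij
    show ?thesis
      by (simp add: beta_mean_def)
  qed
  show ?thesis
    unfolding agree_def
  proof
    fix x assume x: "x \<in> half_open_box a b"
    show "rl_integral a \<beta> i (rl_integral a \<gamma> j f) x = rl_integral a \<gamma> j (rl_integral a \<beta> i f) x"
      using agreeD[OF *[OF ij \<beta>] x] agreeD[OF *[OF ij[symmetric] \<beta>(2,1)] x] ij
        beta_mean_commute[OF p \<beta>(1) p \<beta>(2) h ij half_open_box_imp_box[OF x]]
      by (simp add: fun_upd_twist[OF ij])
  qed
qed

subsection \<open>Derivatives of weighted functions\<close>

lemma partial_deriv_weighted: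
  assumes h: "Ck_on_box (Suc k) a b h" and f: "agree a b f (\<lambda>x. weight a p x * h x)" and p: "p i = 1"
  shows "agree a b (partial_deriv a b i f) (\<lambda>x. weight a p x * partial_deriv a b i h x)"
  unfolding agree_def
proof
  fix x assume x: "x \<in> half_open_box a b"
  note x' = half_open_box_imp_box[OF x] half_open_boxD(1)[OF x, of i] half_open_boxD(2)[OF x, of i]
  have w: "weight a p x = weight_off a p i x"
    using x' by (simp add: weight_split[of a p x i] p)
  have "((\<lambda>t. weight_off a p i x * h (upd_coord x i t)) has_real_derivative
      weight_off a p i x * partial_deriv a b i h x) (at (x $ i) within {a $ i..b $ i})"
    using Ck_on_box_SucD(1)[OF box h] x'(1) by (intro DERIV_cmult) (simp add: has_partial_def)
  then have "((\<lambda>t. f (upd_coord x i t)) has_real_derivative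
      weight_off a p i x * partial_deriv a b i h x) (at (x $ i) within {a $ i..b $ i})"
  proof (rule has_field_derivative_transform_within)
    fix t assume t: "t \<in> {a $ i..b $ i}" "dist t (x $ i) < x $ i - a $ i"
    then have t': "a $ i < t" "t \<le> b $ i" by (auto simp: dist_real_def)
    with agreeD[OF f upd_coord_half_open[OF x t']]
    show "weight_off a p i x * h (upd_coord x i t) = f (upd_coord x i t)"
      by (simp add: weight_upd_coord p)
  qed (use x' in auto)
  from partial_deriv_eqI[OF this x'(1) box]
  show "partial_deriv a b i f x = weight a p x * partial_deriv a b i h x"
    by (simp add: w)
qed

lemma weighted_partial_deriv:
  assumes "weighted a b (Suc k) p f" "p i = 1"
  shows "weighted a b k p (partial_deriv a b i f)"
  using assms partial_deriv_weighted Ck_on_box_SucD(2)[OF box] unfolding weighted_def by blast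

context
  fixes \<alpha> :: real
  assumes \<alpha>: "0 < \<alpha>" "\<alpha> < 1"
begin

text \<open>
  When \<open>p j = 1\<close>, the integral of order \<open>\<alpha>\<close> is $(x_j - a_j)^{\alpha}$ times a mean of class $C^1$, and
  the product rule gives the two terms of \<open>deriv_mean\<close>.
\<close>

lemma rl_integral_has_derivative:
  assumes h: "Ck_on_box (Suc k) a b h" and f: "agree a b f (\<lambda>x. weight a p x * h x)"
    and p: "p j = 1" and x: "x \<in> half_open_box a b"
  shows "((\<lambda>t. rl_integral a \<alpha> j f (upd_coord x j t)) has_real_derivative
           weight a (p(j := \<alpha>)) x * deriv_mean a b \<alpha> j h x) (at (x $ j) within {a $ j..b $ j})"
proof -
  note x' = half_open_box_imp_box[OF x] half_open_boxD(1)[OF x, of j] half_open_boxD(2)[OF x, of j]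
  note h1 = Ck_on_box_SucD[OF box h, of j]
  define w where "w = weight_off a p j x"
  have "has_partial a b j (beta_mean a 1 \<alpha> j h) (beta_mean a 2 \<alpha> j (partial_deriv a b j h))"
    using has_partial_beta_mean_same[OF zero_less_one \<alpha>(1) Ck_on_box_imp_continuous[OF h] h1(1)
        Ck_on_box_imp_continuous[OF h1(2)]] by simp
  then have bm: "((\<lambda>t. beta_mean a 1 \<alpha> j h (upd_coord x j t)) has_real_derivative
      beta_mean a 2 \<alpha> j (partial_deriv a b j h) x) (at (x $ j) within {a $ j..b $ j})"
    using x'(1) by (simp add: has_partial_def)
  have "((\<lambda>u. u powr \<alpha>) \<circ> (\<lambda>t. t - a $ j) has_real_derivative
      \<alpha> * (x $ j - a $ j) powr (\<alpha> - 1) * 1) (at (x $ j) within {a $ j..b $ j})"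
    by (rule DERIV_chain[OF has_real_derivative_powr]) (use x' in \<open>auto intro!: derivative_eq_intros\<close>)
  then have pw: "((\<lambda>t. (t - a $ j) powr \<alpha>) has_real_derivative \<alpha> * (x $ j - a $ j) powr (\<alpha> - 1))
      (at (x $ j) within {a $ j..b $ j})"
    by (simp add: comp_def)
  have "((\<lambda>t. w / Gamma \<alpha> * ((t - a $ j) powr \<alpha> * beta_mean a 1 \<alpha> j h (upd_coord x j t))) has_real_derivative
      w / Gamma \<alpha> * (\<alpha> * (x $ j - a $ j) powr (\<alpha> - 1) * beta_mean a 1 \<alpha> j h (upd_coord x j (x $ j))
        + beta_mean a 2 \<alpha> j (partial_deriv a b j h) x * (x $ j - a $ j) powr \<alpha>))
      (at (x $ j) within {a $ j..b $ j})"
    by (intro DERIV_cmult DERIV_mult pw bm)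
  also have "w / Gamma \<alpha> * (\<alpha> * (x $ j - a $ j) powr (\<alpha> - 1) * beta_mean a 1 \<alpha> j h (upd_coord x j (x $ j))
        + beta_mean a 2 \<alpha> j (partial_deriv a b j h) x * (x $ j - a $ j) powr \<alpha>)
      = weight a (p(j := \<alpha>)) x * deriv_mean a b \<alpha> j h x"
  proof -
    have e: "(x $ j - a $ j) powr \<alpha> = (x $ j - a $ j) * (x $ j - a $ j) powr (\<alpha> - 1)"
      using x' powr_mult_base[of "x $ j - a $ j" "\<alpha> - 1"] by simp
    show ?thesis
      unfolding e by (simp add: weight_split[of a "p(j := \<alpha>)" x j] deriv_mean_def w_def
          algebra_simps add_divide_distrib diff_divide_distrib)
  qed
  finally show ?thesis
  proof (rule has_field_derivative_transform_within)
    fix t assume t: "t \<in> {a $ j..b $ j}" "dist t (x $ j) < x $ j - a $ j"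
    then have t': "a $ j < t" "t \<le> b $ j" by (auto simp: dist_real_def)
    from agreeD[OF rl_integral_weighted[OF Ck_on_box_imp_continuous[OF h] f _ \<alpha>(1)] upd_coord_half_open[OF x t']]
    show "w / Gamma \<alpha> * ((t - a $ j) powr \<alpha> * beta_mean a 1 \<alpha> j h (upd_coord x j t))
        = rl_integral a \<alpha> j f (upd_coord x j t)"
      by (simp add: p weight_upd_coord w_def)
  qed (use x' in auto)
qed

text \<open>Shorthand for the integral and the derivative of order \<open>1 - \<alpha>\<close> and for the partial derivative.\<close>

abbreviation RLI :: "3 \<Rightarrow> scalar_field \<Rightarrow> scalar_field" where
  "RLI \<equiv> rl_integral a (1 - \<alpha>)"

abbreviation RLD :: "3 \<Rightarrow> scalar_field \<Rightarrow> scalar_field" where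
  "RLD \<equiv> rl_deriv a b (1 - \<alpha>)"

abbreviation PD :: "3 \<Rightarrow> scalar_field \<Rightarrow> scalar_field" where
  "PD \<equiv> partial_deriv a b"

lemma rl_deriv_cong: "agree a b f g \<Longrightarrow> agree a b (RLD j f) (RLD j g)"
  unfolding rl_deriv_eq[OF \<alpha>] by (intro partial_deriv_cong rl_integral_cong)

lemma rl_deriv_weighted:
  assumes "Ck_on_box (Suc k) a b h" "agree a b f (\<lambda>x. weight a p x * h x)" "p j = 1"
  shows "agree a b (RLD j f) (\<lambda>x. weight a (p(j := \<alpha>)) x * deriv_mean a b \<alpha> j h x)"
  unfolding agree_def rl_deriv_eq[OF \<alpha>]
  using partial_deriv_eqI[OF rl_integral_has_derivative[OF assms] half_open_box_imp_box box] by blast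

lemma weighted_rl_deriv:
  assumes "weighted a b (Suc k) p f" "p j = 1"
  shows "weighted a b k (p(j := \<alpha>)) (RLD j f)"
proof -
  from assms obtain h where h: "Ck_on_box (Suc k) a b h" "agree a b f (\<lambda>x. weight a p x * h x)"
    and p: "\<forall>i. 0 < p i"
    unfolding weighted_def by auto
  with rl_deriv_weighted[OF h assms(2)] Ck_on_box_deriv_mean[OF box \<alpha>(1) h(1)] \<alpha>(1)
  show ?thesis
    unfolding weighted_def by (intro conjI exI[of _ "deriv_mean a b \<alpha> j h"]) auto
qed

lemma rl_deriv_uminus:
  assumes "weighted a b (Suc k) p f" "p j = 1"
  shows "agree a b (RLD j (\<lambda>y. - f y)) (\<lambda>x. - RLD j f x)"
  unfolding agree_def rl_deriv_eq[OF \<alpha>]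
proof
  fix x assume x: "x \<in> half_open_box a b"
  from assms obtain h where h: "Ck_on_box (Suc k) a b h" "agree a b f (\<lambda>x. weight a p x * h x)"
    unfolding weighted_def by auto
  note d = rl_integral_has_derivative[OF h assms(2) x]
  show "PD j (rl_integral a \<alpha> j (\<lambda>y. - f y)) x = - PD j (rl_integral a \<alpha> j f) x"
    using partial_deriv_eqI[OF d half_open_box_imp_box[OF x] box]
      partial_deriv_eqI[OF DERIV_minus[OF d] half_open_box_imp_box[OF x] box]
    by (simp add: rl_integral_uminus)
qed

text \<open>
  The integral of order \<open>1 - \<alpha>\<close> inverts the derivative of the same order from the left; no boundary
  term appears, because the singular factor of the derivative is retained.
\<close>

lemma rl_integral_rl_deriv:
  assumes "weighted a b (Suc k) p f" "p j = 1"
  shows "agree a b (RLI j (RLD j f)) f"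
proof -
  from assms obtain h where h: "Ck_on_box (Suc k) a b h" "agree a b f (\<lambda>x. weight a p x * h x)"
    unfolding weighted_def by auto
  have h1: "Ck_on_box (Suc 0) a b h"
    using h(1) by (induction k) (use Ck_on_box_Suc_imp[OF box] in blast)+
  have cont: "continuous_on (cbox a b) (deriv_mean a b \<alpha> j h)"
    by (rule Ck_on_box_imp_continuous[OF Ck_on_box_deriv_mean[OF box \<alpha>(1) h(1)]])
  have "agree a b (RLI j (RLD j f)) (\<lambda>x. weight a p x *
      (1 / Gamma (1 - \<alpha>) * beta_mean a \<alpha> (1 - \<alpha>) j (deriv_mean a b \<alpha> j h) x))"
    using rl_integral_weighted[OF cont rl_deriv_weighted[OF h assms(2)], of j "1 - \<alpha>"] \<alpha> assms(2)
    by (simp add: fun_upd_idem)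
  moreover have "Gamma (1 - \<alpha>) > 0"
    using \<alpha> by (intro Gamma_real_pos) simp
  then have "Gamma (1 - \<alpha>) \<noteq> 0"
    by (rule less_imp_neq[symmetric])
  ultimately show ?thesis
    using h(2) beta_mean_deriv_mean[OF box \<alpha> h1 half_open_box_imp_box] by (simp add: agree_def)
qed

text \<open>
  A partial derivative commutes with the fractional derivative in another coordinate; this rests on
  the symmetry of the second partial derivatives of the regular factor.
\<close>

lemma partial_deriv_rl_deriv:
  assumes "weighted a b (Suc (Suc k)) p f" "p i = 1" "p j = 1" "i \<noteq> j"
  shows "agree a b (PD i (RLD j f)) (RLD j (PD i f))"
proof -
  from assms obtain h where h: "Ck_on_box (Suc (Suc k)) a b h" "agree a b f (\<lambda>x. weight a p x * h x)"
    unfolding weighted_def by auto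
  have h2: "Ck_on_box (Suc (Suc 0)) a b h"
    using h(1) by (induction k) (use Ck_on_box_Suc_imp[OF box] in blast)+
  have "agree a b (PD i (RLD j f)) (\<lambda>x. weight a (p(j := \<alpha>)) x * PD i (deriv_mean a b \<alpha> j h) x)"
    by (rule partial_deriv_weighted[OF Ck_on_box_deriv_mean[OF box \<alpha>(1) h(1)] rl_deriv_weighted[OF h assms(3)]])
       (use assms in auto)
  moreover have "PD i (deriv_mean a b \<alpha> j h) x = deriv_mean a b \<alpha> j (PD i h) x" if "x \<in> cbox a b" for x
    by (rule partial_deriv_eq[OF has_partial_deriv_mean[OF box \<alpha>(1) h2 assms(4)] that box])
  moreover have "agree a b (RLD j (PD i f)) (\<lambda>x. weight a (p(j := \<alpha>)) x * deriv_mean a b \<alpha> j (PD i h) x)"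
    by (rule rl_deriv_weighted[OF Ck_on_box_SucD(2)[OF box h(1)] partial_deriv_weighted[OF h assms(2)] assms(3)])
  ultimately show ?thesis
    by (simp add: agree_def half_open_box_imp_box)
qed

section \<open>Fractional curl and divergence\<close>

text \<open>
  For the first term the integral in \<open>j\<close> cancels $D_j$ directly; for the second one the two
  integrals are exchanged first. The two terms are singular on different faces and are integrable
  separately.
\<close>

lemma curl_component:
  assumes f: "Ck_on_box 2 a b f" and g: "Ck_on_box 2 a b g" and ij: "i \<noteq> j"
  shows "agree a b (RLI i (RLI j (\<lambda>x. PD i (RLD j f) x - PD j (RLD i g) x)))
           (\<lambda>x. RLI i (PD i f) x - RLI j (PD j g) x)"
proof -
  let ?one = "\<lambda>_::3. 1 :: real"
  have pos: "0 < 1 - \<alpha>" using \<alpha> by simp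
  note f2 = weighted_one[OF f, unfolded numeral_2_eq_2] and g2 = weighted_one[OF g, unfolded numeral_2_eq_2]
  define S where "S = PD i (RLD j f)"
  define T where "T = PD j (RLD i g)"
  have wS: "weighted a b 0 (?one(j := \<alpha>)) S" and wT: "weighted a b 0 (?one(i := \<alpha>)) T"
    unfolding S_def T_def by (intro weighted_partial_deriv weighted_rl_deriv f2 g2; use ij in simp)+
  have S: "agree a b (RLI j S) (PD i f)" and T: "agree a b (RLI i T) (PD j g)"
    unfolding S_def T_def
    using agree_trans[OF rl_integral_cong[OF partial_deriv_rl_deriv[OF f2 refl refl ij]]
          rl_integral_rl_deriv[OF weighted_partial_deriv[OF f2 refl] refl]]
      agree_trans[OF rl_integral_cong[OF partial_deriv_rl_deriv[OF g2 refl refl ij[symmetric]]]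
          rl_integral_rl_deriv[OF weighted_partial_deriv[OF g2 refl] refl]] by blast+
  have wT': "weighted a b 0 (?one(i := \<alpha>)) (\<lambda>x. - T x)" by (rule weighted_uminus[OF wT])
  have "agree a b (RLI j (\<lambda>x. S x + - T x)) (\<lambda>x. RLI j S x + RLI j (\<lambda>x. - T x) x)"
    by (rule rl_integral_add_weighted[OF wS wT' pos])
  from rl_integral_cong[OF this]
  have "agree a b (RLI i (RLI j (\<lambda>x. S x + - T x))) (RLI i (\<lambda>x. RLI j S x + RLI j (\<lambda>x. - T x) x))" .
  also have "agree a b (RLI i (\<lambda>x. RLI j S x + RLI j (\<lambda>x. - T x) x))
      (\<lambda>x. RLI i (RLI j S) x + RLI i (RLI j (\<lambda>x. - T x)) x)"
    by (rule rl_integral_add_weighted[OF weighted_rl_integral[OF wS pos] weighted_rl_integral[OF wT' pos] pos])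
  also have "agree a b (\<lambda>x. RLI i (RLI j S) x + RLI i (RLI j (\<lambda>x. - T x)) x)
      (\<lambda>x. RLI i (PD i f) x - RLI j (PD j g) x)"
    using rl_integral_cong[OF S, of "1 - \<alpha>" i]
      agree_trans[OF rl_integral_commute[OF wT ij pos pos] rl_integral_cong[OF T, of "1 - \<alpha>" j]]
    by (simp add: agree_def rl_integral_uminus)
  finally show ?thesis by (simp add: S_def T_def)
qed

text \<open>
  The term of index \<open>i\<close> of the divergence: the inner derivative $D_k f$ is still twice differentiable
  in the other two coordinates, so that $\partial_i$ may be moved to the right past $D_j$ and $D_k$.
\<close>

lemma div_component:
  assumes f: "Ck_on_box 3 a b f" and ijk: "i \<noteq> j" "i \<noteq> k" "j \<noteq> k"
  defines "T \<equiv> PD i (RLD j (RLD k f))"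
  shows "weighted a b 0 ((\<lambda>_. 1)(k := \<alpha>, j := \<alpha>)) T" "agree a b (RLI k (RLI j T)) (PD i f)"
    "agree a b (RLI j (RLI k T)) (PD i f)"
proof -
  have pos: "0 < 1 - \<alpha>" using \<alpha> by simp
  note f3 = weighted_one[OF f, unfolded numeral_3_eq_3]
  have wk: "weighted a b (Suc (Suc 0)) ((\<lambda>_. 1)(k := \<alpha>)) (RLD k f)"
    by (rule weighted_rl_deriv[OF f3]) simp
  show w: "weighted a b 0 ((\<lambda>_. 1)(k := \<alpha>, j := \<alpha>)) T"
    unfolding T_def by (intro weighted_partial_deriv weighted_rl_deriv wk) (use ijk in auto)
  note g = weighted_partial_deriv[OF f3 refl, of i]
  have "agree a b T (RLD j (PD i (RLD k f)))"
    unfolding T_def by (rule partial_deriv_rl_deriv[OF wk]) (use ijk in auto)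
  also have "agree a b (RLD j (PD i (RLD k f))) (RLD j (RLD k (PD i f)))"
    by (intro rl_deriv_cong partial_deriv_rl_deriv[OF f3]) (use ijk in auto)
  finally have "agree a b (RLI j T) (RLI j (RLD j (RLD k (PD i f))))"
    by (rule rl_integral_cong)
  also have "agree a b (RLI j (RLD j (RLD k (PD i f)))) (RLD k (PD i f))"
    by (rule rl_integral_rl_deriv[OF weighted_rl_deriv[OF g refl]]) (use ijk in auto)
  finally have "agree a b (RLI k (RLI j T)) (RLI k (RLD k (PD i f)))"
    by (rule rl_integral_cong)
  also have "agree a b (RLI k (RLD k (PD i f))) (PD i f)"
    by (rule rl_integral_rl_deriv[OF g refl])
  finally show kj: "agree a b (RLI k (RLI j T)) (PD i f)" .
  show "agree a b (RLI j (RLI k T)) (PD i f)"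
    by (rule agree_trans[OF rl_integral_commute[OF w ijk(3) pos pos] kj])
qed

lemma div_components:
  assumes f: "Ck_on_box 3 a b f" "Ck_on_box 3 a b g" "Ck_on_box 3 a b h"
    and ijk: "i \<noteq> j" "i \<noteq> k" "j \<noteq> k"
  shows "agree a b (RLI i (RLI j (RLI k
             (\<lambda>x. PD i (RLD j (RLD k f)) x + PD j (RLD i (RLD k g)) x + PD k (RLD i (RLD j h)) x))))
           (\<lambda>x. RLI i (PD i f) x + RLI j (PD j g) x + RLI k (PD k h) x)"
proof -
  have pos: "0 < 1 - \<alpha>" using \<alpha> by simp
  define A where "A = PD i (RLD j (RLD k f))"
  define B where "B = PD j (RLD i (RLD k g))"
  define C where "C = PD k (RLD i (RLD j h))"
  note A = div_component[OF f(1) ijk, folded A_def]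
    and B = div_component[OF f(2) ijk(1)[symmetric] ijk(3,2), folded B_def]
    and C = div_component[OF f(3) ijk(2)[symmetric] ijk(3)[symmetric] ijk(1), folded C_def]
  note I = weighted_rl_integral[OF _ pos]
  have "agree a b (RLI k (\<lambda>x. A x + B x + C x)) (\<lambda>x. RLI k A x + RLI k B x + RLI k C x)"
    by (rule rl_integral_add3_weighted[OF A(1) B(1) C(1) pos])
  then have "agree a b (RLI j (RLI k (\<lambda>x. A x + B x + C x))) (RLI j (\<lambda>x. RLI k A x + RLI k B x + RLI k C x))"
    by (rule rl_integral_cong)
  also have "agree a b (RLI j (\<lambda>x. RLI k A x + RLI k B x + RLI k C x))
      (\<lambda>x. RLI j (RLI k A) x + RLI j (RLI k B) x + RLI j (RLI k C) x)"
    by (rule rl_integral_add3_weighted[OF I[OF A(1)] I[OF B(1)] I[OF C(1)] pos])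
  finally have "agree a b (RLI i (RLI j (RLI k (\<lambda>x. A x + B x + C x))))
      (RLI i (\<lambda>x. RLI j (RLI k A) x + RLI j (RLI k B) x + RLI j (RLI k C) x))"
    by (rule rl_integral_cong)
  also have "agree a b (RLI i (\<lambda>x. RLI j (RLI k A) x + RLI j (RLI k B) x + RLI j (RLI k C) x))
      (\<lambda>x. RLI i (RLI j (RLI k A)) x + RLI i (RLI j (RLI k B)) x + RLI i (RLI j (RLI k C)) x)"
    by (rule rl_integral_add3_weighted[OF I[OF I[OF A(1)]] I[OF I[OF B(1)]] I[OF I[OF C(1)]] pos])
  finally have sum: "agree a b (RLI i (RLI j (RLI k (\<lambda>x. A x + B x + C x))))
      (\<lambda>x. RLI i (RLI j (RLI k A)) x + RLI i (RLI j (RLI k B)) x + RLI i (RLI j (RLI k C)) x)" .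
  have "agree a b (RLI i (RLI j (RLI k A))) (RLI i (PD i f))"
    by (rule rl_integral_cong[OF A(3)])
  moreover have "agree a b (RLI i (RLI j (RLI k B))) (RLI j (PD j g))"
    by (rule agree_trans[OF rl_integral_commute[OF I[OF B(1)] ijk(1) pos pos] rl_integral_cong[OF B(3)]])
  moreover have "agree a b (RLI i (RLI j (RLI k C))) (RLI k (PD k h))"
    by (rule agree_trans[OF rl_integral_cong[OF rl_integral_commute[OF C(1) ijk(3) pos pos]]
          agree_trans[OF rl_integral_commute[OF I[OF C(1)] ijk(2) pos pos] rl_integral_cong[OF C(3)]]])
  ultimately show ?thesis
    using sum by (simp add: agree_def A_def B_def C_def)
qed

text \<open>
  Linearity of the derivatives needs differentiability, hence is available only off the lower
  faces. It is needed for the sign in the identification of vector fields with 2-forms.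
\<close>

lemma rl_deriv_rl_deriv_uminus:
  assumes f: "Ck_on_box 3 a b f" and jk: "j \<noteq> k"
  shows "agree a b (RLD j (RLD k (\<lambda>y. - f y))) (\<lambda>x. - RLD j (RLD k f) x)"
proof -
  note f3 = weighted_one[OF f, unfolded numeral_3_eq_3]
  have "agree a b (RLD j (RLD k (\<lambda>y. - f y))) (RLD j (\<lambda>x. - RLD k f x))"
    by (rule rl_deriv_cong[OF rl_deriv_uminus[OF f3 refl]])
  also have "agree a b (RLD j (\<lambda>x. - RLD k f x)) (\<lambda>x. - RLD j (RLD k f) x)"
    by (rule rl_deriv_uminus[OF weighted_rl_deriv[OF f3 refl]]) (use jk in simp)
  finally show ?thesis .
qed

end

end

theorem corollary1:
  fixes a b :: "real^3" and \<alpha> :: real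
  assumes box: "\<forall>j. a $ j < b $ j"
    and alpha: "0 < \<alpha>" "\<alpha> < 1"
  shows
    "(\<forall>f. Ck_on_box 1 a b f \<longrightarrow>
        (\<forall>x\<in>cbox a b.
           grad_T a b \<alpha> f x =
           field_of_one_form (frac_integral_form a 1 (1 - \<alpha>) (one_form (grad_field a b f))) x)) \<and>
     (\<forall>F. Ck_vector_on_box 2 a b F \<longrightarrow>
        (\<forall>x\<in>cbox a b. (\<forall>j. a $ j < x $ j) \<longrightarrow>
           curl_T a b \<alpha> F x =
           field_of_two_form (frac_integral_form a 2 (1 - \<alpha>) (two_form
             (curl_field a b
               (field_of_one_form (rl_deriv_form a b 1 (1 - \<alpha>) (one_form F)))))) x)) \<and>
     (\<forall>F. Ck_vector_on_box 3 a b F \<longrightarrow>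
        (\<forall>x\<in>cbox a b. (\<forall>j. a $ j < x $ j) \<longrightarrow>
           div_T a b \<alpha> F x =
           field_of_three_form (frac_integral_form a 3 (1 - \<alpha>) (three_form
             (div_field a b
               (field_of_two_form (rl_deriv_form a b 2 (1 - \<alpha>) (two_form F)))))) x))"
proof -
  let ?I = "rl_integral a (1 - \<alpha>)" and ?D = "rl_deriv a b (1 - \<alpha>)" and ?P = "partial_deriv a b"
  have box': "\<And>j. a $ j < b $ j" using box by blast
  have one: "map_form op (Suc 0) \<omega> {Suc 0} = op 1 (\<omega> {Suc 0})"
    "map_form op (Suc 0) \<omega> {2} = op 2 (\<omega> {2})" "map_form op (Suc 0) \<omega> {3} = op 3 (\<omega> {3})" for op \<omega>
    by (simp_all add: map_form_def)
  have two: "map_form op 2 \<omega> {Suc 0, 2} = op 1 (op 2 (\<omega> {Suc 0, 2}))"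
    "map_form op 2 \<omega> {Suc 0, 3} = op 1 (op 3 (\<omega> {Suc 0, 3}))"
    "map_form op 2 \<omega> {2, 3} = op 2 (op 3 (\<omega> {2, 3}))" for op \<omega>
    by (simp_all add: map_form_def)
  have three: "map_form op 3 \<omega> {Suc 0, 2, 3} = op 1 (op 2 (op 3 (\<omega> {Suc 0, 2, 3})))" for op \<omega>
    by (simp add: map_form_def)
  have agreeI: "f x = g x" if "agree a b f g" "x \<in> cbox a b" "\<forall>j. a $ j < x $ j" for f g x
    using that by (simp add: agree_def half_open_box_def)
  show ?thesis
  proof (intro conjI allI ballI impI)
    fix f x
    show "grad_T a b \<alpha> f x =
        field_of_one_form (frac_integral_form a 1 (1 - \<alpha>) (one_form (grad_field a b f))) x"
      unfolding grad_T_def field_of_one_form_def frac_integral_form_def nabla_grad_def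
      by (simp add: vector_3 one one_form_def grad_field_def nabla_grad_def caputo_deriv_eq[OF alpha])
  next
    fix F x
    assume F: "Ck_vector_on_box 2 a b F" and x: "x \<in> cbox a b" "\<forall>j. a $ j < x $ j"
    have C2: "Ck_on_box 2 a b (\<lambda>x. F x $ i)" for i
      using F by (simp add: Ck_vector_on_box_def)
    note curl = curl_component[OF box' alpha C2 C2, THEN agreeI, OF _ x]
    have "(1::3) \<noteq> 2" "(1::3) \<noteq> 3" "(2::3) \<noteq> 3" by simp_all
    note c = curl[OF this(1), of 2 1] curl[OF this(2), of 3 1] curl[OF this(3), of 3 2]
    show "curl_T a b \<alpha> F x = field_of_two_form (frac_integral_form a 2 (1 - \<alpha>) (two_form
             (curl_field a b (field_of_one_form (rl_deriv_form a b 1 (1 - \<alpha>) (one_form F)))))) x"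
      unfolding curl_T_def field_of_two_form_def frac_integral_form_def rl_deriv_form_def
      using c
      by (simp add: vector_3 one two one_form_def two_form_def curl_field_def nabla_curl_def field_of_one_form_def
          caputo_deriv_eq[OF alpha] doubleton_eq_iff)
  next
    fix F x
    assume F: "Ck_vector_on_box 3 a b F" and x: "x \<in> cbox a b" "\<forall>j. a $ j < x $ j"
    have C3: "Ck_on_box 3 a b (\<lambda>x. F x $ i)" for i
      using F by (simp add: Ck_vector_on_box_def)
    have ne: "(1::3) \<noteq> 2" "(1::3) \<noteq> 3" "(2::3) \<noteq> 3" by simp_all
    (* The coefficient of the 2-form in the directions 1 and 3 is minus the second component of the field. *)
    define A where "A = ?P 1 (?D 2 (?D 3 (\<lambda>y. F y $ 1)))"
    define C where "C = ?P 3 (?D 1 (?D 2 (\<lambda>y. F y $ 3)))"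
    have "agree a b (\<lambda>y. - ?D 1 (?D 3 (\<lambda>y. - (F y $ 2))) y) (?D 1 (?D 3 (\<lambda>y. F y $ 2)))"
      using rl_deriv_rl_deriv_uminus[OF box' alpha C3 ne(2)] by (simp add: agree_def)
    from partial_deriv_cong[OF this, of 2]
    have "agree a b (\<lambda>y. A y + ?P 2 (\<lambda>y. - ?D 1 (?D 3 (\<lambda>y. - (F y $ 2))) y) y + C y)
        (\<lambda>y. A y + ?P 2 (?D 1 (?D 3 (\<lambda>y. F y $ 2))) y + C y)"
      by (simp add: agree_def)
    then have "agree a b (?I 1 (?I 2 (?I 3
         (\<lambda>y. A y + ?P 2 (\<lambda>y. - ?D 1 (?D 3 (\<lambda>y. - (F y $ 2))) y) y + C y))))
       (?I 1 (?I 2 (?I 3 (\<lambda>y. A y + ?P 2 (?D 1 (?D 3 (\<lambda>y. F y $ 2))) y + C y))))"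
      by (intro rl_integral_cong)
    also have "agree a b \<dots> (\<lambda>y. ?I 1 (?P 1 (\<lambda>y. F y $ 1)) y + ?I 2 (?P 2 (\<lambda>y. F y $ 2)) y
        + ?I 3 (?P 3 (\<lambda>y. F y $ 3)) y)"
      unfolding A_def C_def by (rule div_components[OF box' alpha C3 C3 C3 ne])
    finally have d: "?I 1 (?I 2 (?I 3
         (\<lambda>y. A y + ?P 2 (\<lambda>y. - ?D 1 (?D 3 (\<lambda>y. - (F y $ 2))) y) y + C y))) x
       = ?I 1 (?P 1 (\<lambda>y. F y $ 1)) x + ?I 2 (?P 2 (\<lambda>y. F y $ 2)) x + ?I 3 (?P 3 (\<lambda>y. F y $ 3)) x"
      by (rule agreeI[OF _ x])
    show "div_T a b \<alpha> F x = field_of_three_form (frac_integral_form a 3 (1 - \<alpha>) (three_form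
             (div_field a b (field_of_two_form (rl_deriv_form a b 2 (1 - \<alpha>) (two_form F)))))) x"
      unfolding div_T_def field_of_three_form_def frac_integral_form_def rl_deriv_form_def
      using d unfolding A_def C_def
      by (simp add: vector_3 two three two_form_def three_form_def div_field_def nabla_div_def field_of_two_form_def
          caputo_deriv_eq[OF alpha] doubleton_eq_iff)
  qed
qed

end
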